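(* Let $U$ be a topological space and let $\{\iota_i:U_i\to U\}_{i\in\mathrm{I}}$ be a family of maps from topological spaces $U_i$ to $U$, indexed by a set $\mathrm{I}$. The following assertions are equivalent: (1) $\{\iota_i:U_i\to U\}_{i\in\mathrm{I}}$ is a gluing covering of $U$; (2) there is a $\mathbf{Top}^{\mathrm{op}}$-gluing data functor $\mathbf{G}$ associated with $\{\iota_i:U_i\to U\}_{i\in\mathrm{I}}$ such that $U$ is the glued-up object along $\mathbf{G}$ through the $\mathbf{Gl}(\mathrm{I})$-family of maps associated with $\{\iota_i:U_i\to U\}_{i\in\mathrm{I}}$; (3) there is a topological space gluing data $\big(\mathrm{I},\{U_i\}_{i\in\mathrm{I}},\{U_{i,j},\upsilon_{i,j}\}_{(i,j)\in\mathrm{I}^2},\{\varphi_{i,j},\varphi_{k,(i,j)}\}_{(i,j,k)\in\mathrm{I}^3}\big)$ associated with $\{\iota_i:U_i\to U\}_{i\in\mathrm{I}}$ such that $U=\bigcup_{i\in\mathrm{I}}\iota_i(U_i)$ and $\iota_j(\upsilon_{j,i}(U_{j,i}))=\iota_i(\upsilon_{i,j}(U_{i,j}))=\iota_i(U_i)\cap\iota_j(U_j)$ for all $i,j\in\mathrm{I}$. The same equivalence holds in the open version: with "gluing open covering" in place of "gluing covering" in (1), "$\mathbf{oTop}^{\mathrm{op}}$-gluing data functor" in place of "$\mathbf{Top}^{\mathrm{op}}$-gluing data functor" in (2), and "topological space gluing data where all the maps are open" in place of "topological space gluing data" in (3).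
   Context: $\mathbf{Top}$ is the category of topological spaces and continuous maps; $\mathbf{oTop}$ is the subcategory with all topological spaces as objects and open continuous maps as morphisms. $f^{\mathrm{op}}$ denotes the morphism corresponding to $f$ in the opposite category. Gluing (open) covering. A gluing covering (respectively gluing open covering) of $U$ is a family $\{\iota_i:U_i\to U\}_{i\in\mathrm{I}}$ such that each $\iota_i$ is a one-to-one continuous map (respectively one-to-one open continuous map) and $\bigcup_{i\in\mathrm{I}}\iota_i(U_i)=U$. Gluing index category. $\mathbf{Gl}(\mathrm{I})$ has as objects the equivalence classes of elements of $\mathrm{I}\cup\mathrm{I}^2\cup\mathrm{I}^3$ under the equivalence relation generated by $i\sim(i,i)$, $(i,j,k)\sim(i,k,j)$, $(i,j,j)\sim(i,j)$; classes are written $[i]$ (or $i$), $[i,j]$, $[i,j,k]$. There is at most one morphism between any two objects. The morphisms are the identities, $\eta_{i,[i,j]}:i\to[i,j]$, $\tau_{[i,j]}:[j,i]\to[i,j]$, $\eta_{[i,n],[i,j,k]}:[i,n]\to[i,j,k]$ for $n\in\{j,k\}$, $\tau_{k,[i,j]}:[j,i,k]\to[i,j,k]$ (for all $i,j,k\in\mathrm{I}$), and their composites. In $\mathbf{Gl}(\mathrm{I})$, $[i,j,k]$ is the pushout of $[i,j]$ and $[i,k]$ over $i$. Gluing data functor. A $\mathbf{C}$-gluing data functor of type $\mathrm{I}$ is a functor $\mathbf{G}:\mathbf{Gl}(\mathrm{I})\to\mathbf{C}$ sending each pushout $[i,j,k]$ to the corresponding pushout in $\mathbf{C}$ (of $\mathbf{G}([i,j])$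 and $\mathbf{G}([i,k])$ over $\mathbf{G}([i])$), the image of $\eta_{[i,n],[i,j,k]}$ being the canonical morphism into that pushout. $L$ is a glued-up $\mathbf{C}$-object along $\mathbf{G}$ through $\pi_L=\{\pi_{L,a}:L\to\mathbf{G}(a)\}_a$ if $\lim\mathbf{G}$ exists and $(L,\pi_L)$ is a cone over $\mathbf{G}$ isomorphic to it. Topological space gluing data. This is a collection $\big(\mathrm{I},\{U_i\}_{i\in\mathrm{I}},\{U_{i,j},\upsilon_{i,j}\}_{(i,j)\in\mathrm{I}^2},\{\varphi_{i,j},\varphi_{k,(i,j)}\}_{(i,j,k)\in\mathrm{I}^3}\big)$ with $\mathrm{I}$ a set, $U_i$, $U_{i,j}$ topological spaces, $\upsilon_{i,j}:U_{i,j}\to U_i$, $\varphi_{i,j}:U_{i,j}\to U_{j,i}$ and $\varphi_{k,(i,j)}:U_{i,j}\times_{U_i}U_{i,k}\to U_{j,i}\times_{U_j}U_{j,k}$ continuous maps, such that for all $i,j,k\in\mathrm{I}$: (a) $U_{i,i}=U_i$; (b) $\varphi_{i,i}=\mathrm{id}_{U_{i,i}}$; (c) $\varphi_{j,(i,k)}=\varphi_{i,(j,k)}\circ\varphi_{k,(i,j)}$ (identifying $U_{i,j}\times_{U_i}U_{i,k}$ with $U_{i,k}\times_{U_i}U_{i,j}$, etc.); (d) $p\circ\varphi_{k,(i,j)}=\varphi_{i,j}\circ q$, where $p:U_{j,i}\times_{U_j}U_{j,k}\to U_{j,i}$ and $q:U_{i,j}\times_{U_i}U_{i,k}\to U_{i,j}$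 are the canonical projections. Pullbacks are taken along the maps $\upsilon$. Association. Let $\{\iota_i:U_i\to U\}_{i\in\mathrm{I}}$ be a gluing (open) covering of $U$. A $\mathbf{Top}^{\mathrm{op}}$- (respectively $\mathbf{oTop}^{\mathrm{op}}$-) gluing data functor $\mathbf{G}$ is associated with it if $\mathbf{G}(i)=U_i$ for all $i\in\mathrm{I}$ and $U$ is the glued-up object along $\mathbf{G}$ through (the opposite of) the family $\iota=\{\iota_a\}_{a\in\mathrm{Ob}(\mathbf{Gl}(\mathrm{I}))}$ given by the $\iota_i$, $\iota_{[i,j]}=\iota_i\circ\mathbf{G}(\eta_{i,[i,j]})^{\mathrm{op}}$ and $\iota_{[i,j,k]}=\iota_{[i,j]}\circ\mathbf{G}(\eta_{[i,j],[i,j,k]})^{\mathrm{op}}$; this $\iota$ is called the $\mathbf{Gl}(\mathrm{I})$-family of maps associated with $\{\iota_i\}_{i\in\mathrm{I}}$. A topological space gluing data (respectively one where all the maps are open) with spaces $U_i$ is associated with $\{\iota_i\}_{i\in\mathrm{I}}$ if $U=\bigcup_{i\in\mathrm{I}}\iota_i(U_i)$ and $\iota_j(\upsilon_{j,i}(U_{j,i}))=\iota_i(\upsilon_{i,j}(U_{i,j}))=\iota_i(U_i)\cap\iota_j(U_j)$ for all $i,j\in\mathrm{I}$.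
   Formalization: Non-open (1)⇒(2) and (3)⇒(2) assume U has the final topology for the ι_i (false otherwise: U_1 discrete, U indiscrete, ι_1=id); in (3), associated data presuppose that the ι_i form a gluing (open) covering; Top, oTop: spaces in an arbitrary infinite universe in which I is small. *)

theory Defs
  imports "HOL-Analysis.Analysis" "HOL-Library.Equipollence"
begin

section \<open>Categories, opposite categories, limits and pushouts\<close>

text \<open>\<open>Comp C a b c g f\<close> is the composite of \<open>f : a \<rightarrow> b\<close> followed by \<open>g : b \<rightarrow> c\<close>. The objects
  are arguments of \<open>Comp\<close> because the hom-sets of a category need not be disjoint.\<close>

record ('o, 'm) cat =
  Ob :: "'o set"
  Hom :: "'o \<Rightarrow> 'o \<Rightarrow> 'm set"
  Id :: "'o \<Rightarrow> 'm"
  Comp :: "'o \<Rightarrow> 'o \<Rightarrow> 'o \<Rightarrow> 'm \<Rightarrow> 'm \<Rightarrow> 'm"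

definition is_category :: "('o, 'm) cat \<Rightarrow> bool" where
  "is_category C \<longleftrightarrow>
     (\<forall>a\<in>Ob C. Id C a \<in> Hom C a a) \<and>
     (\<forall>a\<in>Ob C. \<forall>b\<in>Ob C. \<forall>c\<in>Ob C. \<forall>f\<in>Hom C a b. \<forall>g\<in>Hom C b c. Comp C a b c g f \<in> Hom C a c) \<and>
     (\<forall>a\<in>Ob C. \<forall>b\<in>Ob C. \<forall>f\<in>Hom C a b. Comp C a a b f (Id C a) = f \<and> Comp C a b b (Id C b) f = f) \<and>
     (\<forall>a\<in>Ob C. \<forall>b\<in>Ob C. \<forall>c\<in>Ob C. \<forall>d\<in>Ob C. \<forall>f\<in>Hom C a b. \<forall>g\<in>Hom C b c. \<forall>h\<in>Hom C c d.
        Comp C a c d h (Comp C a b c g f) = Comp C a b d (Comp C b c d h g) f)"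

definition op_cat :: "('o, 'm) cat \<Rightarrow> ('o, 'm) cat" where
  "op_cat C = \<lparr>Ob = Ob C, Hom = (\<lambda>a b. Hom C b a), Id = Id C,
     Comp = (\<lambda>a b c g f. Comp C c b a f g)\<rparr>"

record ('j, 'n, 'o, 'm) fctr =
  fob :: "'j \<Rightarrow> 'o"
  fmor :: "'j \<Rightarrow> 'j \<Rightarrow> 'n \<Rightarrow> 'm"

definition is_functor :: "('j, 'n) cat \<Rightarrow> ('o, 'm) cat \<Rightarrow> ('j, 'n, 'o, 'm) fctr \<Rightarrow> bool" where
  "is_functor J C G \<longleftrightarrow>
     (\<forall>a\<in>Ob J. fob G a \<in> Ob C) \<and>
     (\<forall>a\<in>Ob J. \<forall>b\<in>Ob J. \<forall>f\<in>Hom J a b. fmor G a b f \<in> Hom C (fob G a) (fob G b)) \<and>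
     (\<forall>a\<in>Ob J. fmor G a a (Id J a) = Id C (fob G a)) \<and>
     (\<forall>a\<in>Ob J. \<forall>b\<in>Ob J. \<forall>c\<in>Ob J. \<forall>f\<in>Hom J a b. \<forall>g\<in>Hom J b c.
        fmor G a c (Comp J a b c g f) =
          Comp C (fob G a) (fob G b) (fob G c) (fmor G b c g) (fmor G a b f))"

definition is_cone ::
  "('j, 'n) cat \<Rightarrow> ('o, 'm) cat \<Rightarrow> ('j, 'n, 'o, 'm) fctr \<Rightarrow> 'o \<Rightarrow> ('j \<Rightarrow> 'm) \<Rightarrow> bool" where
  "is_cone J C G L p \<longleftrightarrow>
     L \<in> Ob C \<and> (\<forall>a\<in>Ob J. p a \<in> Hom C L (fob G a)) \<and>
     (\<forall>a\<in>Ob J. \<forall>b\<in>Ob J. \<forall>f\<in>Hom J a b.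
        Comp C L (fob G a) (fob G b) (fmor G a b f) (p a) = p b)"

definition is_limit ::
  "('j, 'n) cat \<Rightarrow> ('o, 'm) cat \<Rightarrow> ('j, 'n, 'o, 'm) fctr \<Rightarrow> 'o \<Rightarrow> ('j \<Rightarrow> 'm) \<Rightarrow> bool" where
  "is_limit J C G L p \<longleftrightarrow>
     is_cone J C G L p \<and>
     (\<forall>Y q. is_cone J C G Y q \<longrightarrow>
        (\<exists>!h. h \<in> Hom C Y L \<and> (\<forall>a\<in>Ob J. Comp C Y L (fob G a) (p a) h = q a)))"

definition is_iso :: "('o, 'm) cat \<Rightarrow> 'o \<Rightarrow> 'o \<Rightarrow> 'm \<Rightarrow> bool" where
  "is_iso C a b f \<longleftrightarrow> f \<in> Hom C a b \<and>
     (\<exists>g\<in>Hom C b a. Comp C a b a g f = Id C a \<and> Comp C b a b f g = Id C b)"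

definition is_glued_up ::
  "('j, 'n) cat \<Rightarrow> ('o, 'm) cat \<Rightarrow> ('j, 'n, 'o, 'm) fctr \<Rightarrow> 'o \<Rightarrow> ('j \<Rightarrow> 'm) \<Rightarrow> bool" where
  "is_glued_up J C G L p \<longleftrightarrow>
     is_cone J C G L p \<and>
     (\<exists>P q. is_limit J C G P q \<and>
        (\<exists>h. is_iso C L P h \<and> (\<forall>a\<in>Ob J. Comp C L P (fob G a) (q a) h = p a)))"

text \<open>\<open>P\<close> with \<open>p : b \<rightarrow> P\<close> and \<open>q : c \<rightarrow> P\<close> is the pushout of \<open>f : a \<rightarrow> b\<close> and \<open>g : a \<rightarrow> c\<close>.\<close>

definition is_pushout ::
  "('o, 'm) cat \<Rightarrow> 'o \<Rightarrow> 'o \<Rightarrow> 'o \<Rightarrow> 'm \<Rightarrow> 'm \<Rightarrow> 'o \<Rightarrow> 'm \<Rightarrow> 'm \<Rightarrow> bool" where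
  "is_pushout C a b c f g P p q \<longleftrightarrow>
     P \<in> Ob C \<and> p \<in> Hom C b P \<and> q \<in> Hom C c P \<and> Comp C a b P p f = Comp C a c P q g \<and>
     (\<forall>Y\<in>Ob C. \<forall>r\<in>Hom C b Y. \<forall>s\<in>Hom C c Y. Comp C a b Y r f = Comp C a c Y s g \<longrightarrow>
        (\<exists>!h. h \<in> Hom C P Y \<and> Comp C b P Y h p = r \<and> Comp C c P Y h q = s))"

section \<open>The categories of topological spaces\<close>

text \<open>The type \<open>'u\<close> plays the role of the universe in which the spaces live: the objects are the
  topological spaces whose underlying set is a subset of \<open>'u\<close>. Morphisms are extensional
  functions, so that equality of morphisms is equality on the underlying set of the domain.\<close>

definition Top :: "('u topology, 'u \<Rightarrow> 'u) cat" where
  "Top = \<lparr>Ob = UNIV,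
     Hom = (\<lambda>X Y. {f \<in> extensional (topspace X). continuous_map X Y f}),
     Id = (\<lambda>X. restrict id (topspace X)),
     Comp = (\<lambda>X Y Z g f. compose (topspace X) g f)\<rparr>"

definition oTop :: "('u topology, 'u \<Rightarrow> 'u) cat" where
  "oTop = \<lparr>Ob = UNIV,
     Hom = (\<lambda>X Y. {f \<in> extensional (topspace X). continuous_map X Y f \<and> open_map X Y f}),
     Id = (\<lambda>X. restrict id (topspace X)),
     Comp = (\<lambda>X Y Z g f. compose (topspace X) g f)\<rparr>"

section \<open>The gluing index category\<close>

datatype 'i gl_word = One 'i | Two 'i 'i | Three 'i 'i 'i

definition gl_words :: "'i set \<Rightarrow> 'i gl_word set" where
  "gl_words I = {One i |i. i \<in> I} \<union> {Two i j |i j. i \<in> I \<and> j \<in> I} \<union>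
     {Three i j k |i j k. i \<in> I \<and> j \<in> I \<and> k \<in> I}"

inductive_set gl_equiv :: "'i set \<Rightarrow> ('i gl_word \<times> 'i gl_word) set" for I :: "'i set" where
  diag: "i \<in> I \<Longrightarrow> (One i, Two i i) \<in> gl_equiv I"
| swap: "\<lbrakk>i \<in> I; j \<in> I; k \<in> I\<rbrakk> \<Longrightarrow> (Three i j k, Three i k j) \<in> gl_equiv I"
| dupl: "\<lbrakk>i \<in> I; j \<in> I\<rbrakk> \<Longrightarrow> (Three i j j, Two i j) \<in> gl_equiv I"
| refl: "w \<in> gl_words I \<Longrightarrow> (w, w) \<in> gl_equiv I"
| sym: "(v, w) \<in> gl_equiv I \<Longrightarrow> (w, v) \<in> gl_equiv I"
| trans: "\<lbrakk>(u, v) \<in> gl_equiv I; (v, w) \<in> gl_equiv I\<rbrakk> \<Longrightarrow> (u, w) \<in> gl_equiv I"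

definition gl1 :: "'i set \<Rightarrow> 'i \<Rightarrow> 'i gl_word set" where
  "gl1 I i = gl_equiv I `` {One i}"

definition gl2 :: "'i set \<Rightarrow> 'i \<Rightarrow> 'i \<Rightarrow> 'i gl_word set" where
  "gl2 I i j = gl_equiv I `` {Two i j}"

definition gl3 :: "'i set \<Rightarrow> 'i \<Rightarrow> 'i \<Rightarrow> 'i \<Rightarrow> 'i gl_word set" where
  "gl3 I i j k = gl_equiv I `` {Three i j k}"

inductive gl_arrow :: "'i set \<Rightarrow> 'i gl_word set \<Rightarrow> 'i gl_word set \<Rightarrow> bool" for I :: "'i set" where
  ident: "a \<in> gl_words I // gl_equiv I \<Longrightarrow> gl_arrow I a a"
| eta2: "\<lbrakk>i \<in> I; j \<in> I\<rbrakk> \<Longrightarrow> gl_arrow I (gl1 I i) (gl2 I i j)"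
| tau2: "\<lbrakk>i \<in> I; j \<in> I\<rbrakk> \<Longrightarrow> gl_arrow I (gl2 I j i) (gl2 I i j)"
| eta3: "\<lbrakk>i \<in> I; j \<in> I; k \<in> I; n \<in> {j, k}\<rbrakk> \<Longrightarrow> gl_arrow I (gl2 I i n) (gl3 I i j k)"
| tau3: "\<lbrakk>i \<in> I; j \<in> I; k \<in> I\<rbrakk> \<Longrightarrow> gl_arrow I (gl3 I j i k) (gl3 I i j k)"
| comp: "\<lbrakk>gl_arrow I a b; gl_arrow I b c\<rbrakk> \<Longrightarrow> gl_arrow I a c"

text \<open>There is at most one morphism between two objects, so the morphisms can all be called \<open>()\<close>.\<close>

definition Gl :: "'i set \<Rightarrow> ('i gl_word set, unit) cat" where
  "Gl I = \<lparr>Ob = gl_words I // gl_equiv I, Hom = (\<lambda>a b. {m. gl_arrow I a b}),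
     Id = (\<lambda>a. ()), Comp = (\<lambda>a b c g f. ())\<rparr>"

lemma equiv_gl_equiv: "equiv (gl_words I) (gl_equiv I)"
proof (rule equivI)
  have "u \<in> gl_words I \<and> v \<in> gl_words I" if "(u, v) \<in> gl_equiv I" for u v
    using that by (induction rule: gl_equiv.induct) (auto simp: gl_words_def)
  then show "gl_equiv I \<subseteq> gl_words I \<times> gl_words I" by auto
  show "refl_on (gl_words I) (gl_equiv I)"
    by (auto simp: refl_on_def intro: gl_equiv.refl)
  show "sym (gl_equiv I)" by (auto simp: sym_def intro: gl_equiv.sym)
  show "trans (gl_equiv I)" by (auto simp: trans_def intro: gl_equiv.trans)
qed

lemma is_category_op_cat: "is_category C \<Longrightarrow> is_category (op_cat C)"
  unfolding is_category_def op_cat_def by auto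

lemma is_category_Gl: "is_category (Gl I)"
  unfolding is_category_def Gl_def by (auto intro: gl_arrow.ident gl_arrow.comp)

lemma continuous_map_compose_extensional:
  "continuous_map X Y f \<Longrightarrow> continuous_map Y Z g \<Longrightarrow> continuous_map X Z (compose (topspace X) g f)"
  by (rule continuous_map_eq[of X Z "g \<circ> f"]) (auto simp: compose_def intro: continuous_map_compose)

lemma open_map_compose_extensional:
  "open_map X Y f \<Longrightarrow> open_map Y Z g \<Longrightarrow> open_map X Z (compose (topspace X) g f)"
  by (rule open_map_eq[of X Z "g \<circ> f"]) (auto simp: compose_def intro: open_map_compose)

lemma is_category_Top: "is_category Top"
  unfolding is_category_def Top_def
  by (auto simp: continuous_map_compose_extensional compose_def extensional_def fun_eq_iff
      intro: continuous_map_eq[OF continuous_map_id] continuous_map_compose[unfolded o_def]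
      dest: continuous_map_image_subset_topspace)

lemma is_category_oTop: "is_category oTop"
  unfolding is_category_def oTop_def
  by (auto simp: continuous_map_compose_extensional compose_def extensional_def fun_eq_iff
      intro: continuous_map_eq[OF continuous_map_id] open_map_eq[OF open_map_id]
        continuous_map_compose[unfolded o_def] open_map_compose_extensional[unfolded compose_def]
      dest: continuous_map_image_subset_topspace)

section \<open>Gluing data functors\<close>

definition gluing_data_functor ::
  "('o, 'm) cat \<Rightarrow> 'i set \<Rightarrow> ('i gl_word set, unit, 'o, 'm) fctr \<Rightarrow> bool" where
  "gluing_data_functor C I G \<longleftrightarrow>
     is_functor (Gl I) C G \<and>
     (\<forall>i\<in>I. \<forall>j\<in>I. \<forall>k\<in>I.
        is_pushout C (fob G (gl1 I i)) (fob G (gl2 I i j)) (fob G (gl2 I i k))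
          (fmor G (gl1 I i) (gl2 I i j) ()) (fmor G (gl1 I i) (gl2 I i k) ())
          (fob G (gl3 I i j k))
          (fmor G (gl2 I i j) (gl3 I i j k) ()) (fmor G (gl2 I i k) (gl3 I i j k) ()))"

section \<open>Gluing coverings\<close>

text \<open>In what follows \<open>U\<close> is the space to be covered and \<open>\<iota> i : X i \<rightarrow> U\<close> for \<open>i \<in> I\<close>.\<close>

definition gluing_covering ::
  "'i set \<Rightarrow> 'u topology \<Rightarrow> ('i \<Rightarrow> 'u topology) \<Rightarrow> ('i \<Rightarrow> 'u \<Rightarrow> 'u) \<Rightarrow> bool" where
  "gluing_covering I U X \<iota> \<longleftrightarrow>
     (\<forall>i\<in>I. continuous_map (X i) U (\<iota> i) \<and> inj_on (\<iota> i) (topspace (X i))) \<and>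
     (\<Union>i\<in>I. \<iota> i ` topspace (X i)) = topspace U"

definition gluing_open_covering ::
  "'i set \<Rightarrow> 'u topology \<Rightarrow> ('i \<Rightarrow> 'u topology) \<Rightarrow> ('i \<Rightarrow> 'u \<Rightarrow> 'u) \<Rightarrow> bool" where
  "gluing_open_covering I U X \<iota> \<longleftrightarrow>
     (\<forall>i\<in>I. continuous_map (X i) U (\<iota> i) \<and> open_map (X i) U (\<iota> i) \<and>
        inj_on (\<iota> i) (topspace (X i))) \<and>
     (\<Union>i\<in>I. \<iota> i ` topspace (X i)) = topspace U"

text \<open>\<open>U\<close> carries the finest topology for which all \<open>\<iota> i\<close> are continuous. This is automatic for a
  gluing open covering, but not for a gluing covering: the identity from a discrete space to the
  same set with a coarser topology is a gluing covering indexed by one element.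
  For one index \<open>Gl I\<close> has one object and one morphism, so \<open>\<iota> i\<close> would have to be a homeomorphism
  for \<open>U\<close> to be glued up along a functor.\<close>

definition final_topology ::
  "'i set \<Rightarrow> 'u topology \<Rightarrow> ('i \<Rightarrow> 'u topology) \<Rightarrow> ('i \<Rightarrow> 'u \<Rightarrow> 'u) \<Rightarrow> bool" where
  "final_topology I U X \<iota> \<longleftrightarrow>
     (\<forall>V. openin U V \<longleftrightarrow>
        V \<subseteq> topspace U \<and> (\<forall>i\<in>I. openin (X i) {x \<in> topspace (X i). \<iota> i x \<in> V}))"

section \<open>Association of gluing data functors\<close>

text \<open>\<open>C\<close> is \<open>Top\<close> or \<open>oTop\<close> and \<open>G\<close> takes values in \<open>op_cat C\<close>, so that \<open>fmor G a b ()\<close> is a map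
  from \<open>fob G b\<close> to \<open>fob G a\<close>. The conditions determine the family \<open>l\<close> on the objects of \<open>Gl I\<close>.\<close>

definition Gl_family ::
  "('u topology, 'u \<Rightarrow> 'u) cat \<Rightarrow> 'i set \<Rightarrow> 'u topology \<Rightarrow> ('i \<Rightarrow> 'u topology) \<Rightarrow> ('i \<Rightarrow> 'u \<Rightarrow> 'u) \<Rightarrow>
   ('i gl_word set, unit, 'u topology, 'u \<Rightarrow> 'u) fctr \<Rightarrow> ('i gl_word set \<Rightarrow> 'u \<Rightarrow> 'u) \<Rightarrow> bool" where
  "Gl_family C I U X \<iota> G l \<longleftrightarrow>
     (\<forall>i\<in>I. l (gl1 I i) = restrict (\<iota> i) (topspace (X i))) \<and>
     (\<forall>i\<in>I. \<forall>j\<in>I. l (gl2 I i j) =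
        Comp C (fob G (gl2 I i j)) (fob G (gl1 I i)) U
          (l (gl1 I i)) (fmor G (gl1 I i) (gl2 I i j) ())) \<and>
     (\<forall>i\<in>I. \<forall>j\<in>I. \<forall>k\<in>I. l (gl3 I i j k) =
        Comp C (fob G (gl3 I i j k)) (fob G (gl2 I i j)) U
          (l (gl2 I i j)) (fmor G (gl2 I i j) (gl3 I i j k) ()))"

definition glued_by_functor ::
  "('u topology, 'u \<Rightarrow> 'u) cat \<Rightarrow> 'i set \<Rightarrow> 'u topology \<Rightarrow> ('i \<Rightarrow> 'u topology) \<Rightarrow> ('i \<Rightarrow> 'u \<Rightarrow> 'u) \<Rightarrow>
   ('i gl_word set, unit, 'u topology, 'u \<Rightarrow> 'u) fctr \<Rightarrow> bool" where
  "glued_by_functor C I U X \<iota> G \<longleftrightarrow>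
     (\<exists>l. Gl_family C I U X \<iota> G l \<and> is_glued_up (Gl I) (op_cat C) G U l)"

definition associated_functor ::
  "('u topology, 'u \<Rightarrow> 'u) cat \<Rightarrow> 'i set \<Rightarrow> 'u topology \<Rightarrow> ('i \<Rightarrow> 'u topology) \<Rightarrow> ('i \<Rightarrow> 'u \<Rightarrow> 'u) \<Rightarrow>
   ('i gl_word set, unit, 'u topology, 'u \<Rightarrow> 'u) fctr \<Rightarrow> bool" where
  "associated_functor C I U X \<iota> G \<longleftrightarrow>
     gluing_data_functor (op_cat C) I G \<and> (\<forall>i\<in>I. fob G (gl1 I i) = X i) \<and>
     glued_by_functor C I U X \<iota> G"

section \<open>Topological space gluing data\<close>

definition pullback_space ::
  "'a topology \<Rightarrow> 'b topology \<Rightarrow> ('a \<Rightarrow> 'c) \<Rightarrow> ('b \<Rightarrow> 'c) \<Rightarrow> ('a \<times> 'b) topology" where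
  "pullback_space A B f g = subtopology (prod_topology A B) {(x, y). f x = g y}"

text \<open>In a record \<open>D\<close>, \<open>phi D i j\<close> is \<open>\<phi>\<^bsub>i,j\<^esub>\<close> and \<open>phi3 D k i j\<close> is \<open>\<phi>\<^bsub>k,(i,j)\<^esub>\<close>.\<close>

record ('i, 'u) gluing_data =
  spc :: "'i \<Rightarrow> 'u topology"
  ovl :: "'i \<Rightarrow> 'i \<Rightarrow> 'u topology"
  ups :: "'i \<Rightarrow> 'i \<Rightarrow> 'u \<Rightarrow> 'u"
  phi :: "'i \<Rightarrow> 'i \<Rightarrow> 'u \<Rightarrow> 'u"
  phi3 :: "'i \<Rightarrow> 'i \<Rightarrow> 'i \<Rightarrow> 'u \<times> 'u \<Rightarrow> 'u \<times> 'u"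

definition triple :: "('i, 'u) gluing_data \<Rightarrow> 'i \<Rightarrow> 'i \<Rightarrow> 'i \<Rightarrow> ('u \<times> 'u) topology" where
  "triple D i j k = pullback_space (ovl D i j) (ovl D i k) (ups D i j) (ups D i k)"

text \<open>In the penultimate clause, \<open>prod.swap\<close> is the identification of
  \<open>U\<^bsub>i,j\<^esub> \<times> U\<^bsub>i,k\<^esub>\<close> (over \<open>U\<^bsub>i\<^esub>\<close>) with \<open>U\<^bsub>i,k\<^esub> \<times> U\<^bsub>i,j\<^esub>\<close>, and similarly for the other index triples.\<close>

definition top_gluing_data :: "'i set \<Rightarrow> ('i, 'u) gluing_data \<Rightarrow> bool" where
  "top_gluing_data I D \<longleftrightarrow>
     (\<forall>i\<in>I. \<forall>j\<in>I. continuous_map (ovl D i j) (spc D i) (ups D i j)) \<and>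
     (\<forall>i\<in>I. \<forall>j\<in>I. continuous_map (ovl D i j) (ovl D j i) (phi D i j)) \<and>
     (\<forall>i\<in>I. \<forall>j\<in>I. \<forall>k\<in>I. continuous_map (triple D i j k) (triple D j i k) (phi3 D k i j)) \<and>
     (\<forall>i\<in>I. ovl D i i = spc D i) \<and>
     (\<forall>i\<in>I. \<forall>x\<in>topspace (ovl D i i). phi D i i x = x) \<and>
     (\<forall>i\<in>I. \<forall>j\<in>I. \<forall>k\<in>I. \<forall>z\<in>topspace (triple D i j k).
        phi3 D j i k (prod.swap z) = prod.swap (phi3 D i j k (prod.swap (phi3 D k i j z)))) \<and>
     (\<forall>i\<in>I. \<forall>j\<in>I. \<forall>k\<in>I. \<forall>z\<in>topspace (triple D i j k).
        fst (phi3 D k i j z) = phi D i j (fst z))"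

definition all_maps_open :: "'i set \<Rightarrow> ('i, 'u) gluing_data \<Rightarrow> bool" where
  "all_maps_open I D \<longleftrightarrow>
     (\<forall>i\<in>I. \<forall>j\<in>I. open_map (ovl D i j) (spc D i) (ups D i j)) \<and>
     (\<forall>i\<in>I. \<forall>j\<in>I. open_map (ovl D i j) (ovl D j i) (phi D i j)) \<and>
     (\<forall>i\<in>I. \<forall>j\<in>I. \<forall>k\<in>I. open_map (triple D i j k) (triple D j i k) (phi3 D k i j))"

definition covers_with_overlaps ::
  "'i set \<Rightarrow> 'u topology \<Rightarrow> ('i \<Rightarrow> 'u \<Rightarrow> 'u) \<Rightarrow> ('i, 'u) gluing_data \<Rightarrow> bool" where
  "covers_with_overlaps I U \<iota> D \<longleftrightarrow>
     topspace U = (\<Union>i\<in>I. \<iota> i ` topspace (spc D i)) \<and>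
     (\<forall>i\<in>I. \<forall>j\<in>I.
        \<iota> j ` ups D j i ` topspace (ovl D j i) = \<iota> i ` ups D i j ` topspace (ovl D i j) \<and>
        \<iota> i ` ups D i j ` topspace (ovl D i j) =
          \<iota> i ` topspace (spc D i) \<inter> \<iota> j ` topspace (spc D j))"

text \<open>Gluing data are associated with gluing (open) coverings only, so being a covering is part of
  the definition; the remaining conditions do not make the maps \<open>\<iota> i\<close> injective or continuous
  (take one index, \<open>ups\<close>, \<open>phi\<close> and \<open>phi3\<close> identities, and \<open>\<iota> i\<close> any surjection). For functors no
  such clause is needed, since there the covering property follows from the universal property.\<close>

definition associated_data ::
  "'i set \<Rightarrow> 'u topology \<Rightarrow> ('i \<Rightarrow> 'u topology) \<Rightarrow> ('i \<Rightarrow> 'u \<Rightarrow> 'u) \<Rightarrow> ('i, 'u) gluing_data \<Rightarrow> bool" where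
  "associated_data I U X \<iota> D \<longleftrightarrow>
     gluing_covering I U X \<iota> \<and>
     top_gluing_data I D \<and> (\<forall>i\<in>I. spc D i = X i) \<and> covers_with_overlaps I U \<iota> D"

definition associated_open_data ::
  "'i set \<Rightarrow> 'u topology \<Rightarrow> ('i \<Rightarrow> 'u topology) \<Rightarrow> ('i \<Rightarrow> 'u \<Rightarrow> 'u) \<Rightarrow> ('i, 'u) gluing_data \<Rightarrow> bool" where
  "associated_open_data I U X \<iota> D \<longleftrightarrow>
     gluing_open_covering I U X \<iota> \<and>
     top_gluing_data I D \<and> all_maps_open I D \<and> (\<forall>i\<in>I. spc D i = X i) \<and>
     covers_with_overlaps I U \<iota> D"

end

theory Submission
  imports Defs
begin

text \<open>
  The plain and the open version have the same proof; a flag \<open>op\<close> distinguishes \<open>Top\<close> from \<open>oTop\<close>.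
  Since \<open>G\<close> takes values in the opposite category, the pushouts of \<open>Gl I\<close> become fibre products and
  the limit becomes a colimit: a space \<open>U\<close> obtained by gluing.

  Suppose that \<open>U\<close> is glued up along \<open>G\<close>. Testing the fibre products \<open>G [i, j, k]\<close> against the
  topological ones, whose projections are open when the given maps are, shows that two points of
  \<open>G [i, j]\<close> and \<open>G [i, k]\<close> over the same point of \<open>G [i]\<close> lift to \<open>G [i, j, k]\<close>
  (\<open>triple_overlap_point\<close>). This is the cocycle condition for the identifications between points of
  the pieces, which therefore form an equivalence relation (\<open>equiv_glue_rel\<close>), and as \<open>G [i, i]\<close> is
  \<open>G [i]\<close>, distinct points of one piece are never identified. So the pieces inject into the quotient
  of their disjoint union, and because the quotient receives a map from \<open>U\<close>, they inject into \<open>U\<close>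
  (\<open>glued_up_leg_inj\<close>). That the pieces cover \<open>U\<close> follows by mapping \<open>U\<close> to the union of their
  images (\<open>glued_up_leg_cover\<close>).

  Conversely, a covering gives a functor by sending \<open>a\<close> to the fibre product over \<open>U\<close> of the pieces
  whose indices occur in \<open>a\<close>. It is realised inside one of these pieces, with a topology that may be
  finer than the subspace topology when the maps are not open (\<open>overlap\<close>). All these spaces inject
  into \<open>U\<close>, which makes every diagram commute, and the universal property of \<open>U\<close> amounts to gluing
  functions; continuity of the result is the hypothesis that \<open>U\<close> has the final topology, which is
  automatic for open coverings. The same spaces furnish the topological gluing data. In the other
  direction nothing has to be proved, since associated gluing data belong to a covering by
  definition.
\<close>

section \<open>Both categories of spaces at once\<close>

text \<open>The two versions of the result have the same proof. A flag says whether morphisms are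
  required to be open.\<close>

definition top_cat :: "bool \<Rightarrow> ('u topology, 'u \<Rightarrow> 'u) cat" where
  "top_cat op = (if op then oTop else Top)"

definition top_mor :: "bool \<Rightarrow> 'a topology \<Rightarrow> 'b topology \<Rightarrow> ('a \<Rightarrow> 'b) \<Rightarrow> bool" where
  "top_mor op X Y f \<longleftrightarrow> continuous_map X Y f \<and> (op \<longrightarrow> open_map X Y f)"

lemma is_category_top_cat: "is_category (top_cat op)"
  by (simp add: top_cat_def is_category_Top is_category_oTop)

lemma top_cat_simps:
  "Ob (top_cat op) = UNIV"
  "Hom (top_cat op) X Y = {f \<in> extensional (topspace X). top_mor op X Y f}"
  "Id (top_cat op) X = restrict id (topspace X)"
  "Comp (top_cat op) X Y Z g f = compose (topspace X) g f"
  by (auto simp: top_cat_def Top_def oTop_def top_mor_def)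

lemma op_cat_simps:
  "Ob (op_cat C) = Ob C"
  "Hom (op_cat C) a b = Hom C b a"
  "Id (op_cat C) = Id C"
  "Comp (op_cat C) a b c g f = Comp C c b a f g"
  by (simp_all add: op_cat_def)

lemma top_mor_funcset: "top_mor op X Y f \<Longrightarrow> f \<in> topspace X \<rightarrow> topspace Y"
  by (simp add: top_mor_def continuous_map_funspace)

lemma top_mor_eq: "top_mor op X Y f \<Longrightarrow> (\<And>x. x \<in> topspace X \<Longrightarrow> f x = g x) \<Longrightarrow> top_mor op X Y g"
  unfolding top_mor_def by (auto intro: continuous_map_eq[of X Y f g] open_map_eq[of X Y f g])

lemma top_mor_restrict: "top_mor op X Y (restrict f (topspace X)) \<longleftrightarrow> top_mor op X Y f"
  using top_mor_eq[of op X Y f "restrict f (topspace X)"]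
    top_mor_eq[of op X Y "restrict f (topspace X)" f] by auto

lemma top_mor_compose: "top_mor op X Y f \<Longrightarrow> top_mor op Y Z g \<Longrightarrow> top_mor op X Z (g \<circ> f)"
  unfolding top_mor_def by (auto intro: continuous_map_compose open_map_compose)

lemma homeomorphic_maps_top_mor:
  "homeomorphic_maps X Y f g \<Longrightarrow> top_mor op X Y f \<and> top_mor op Y X g"
  unfolding homeomorphic_maps_map top_mor_def
  by (auto simp: homeomorphic_imp_continuous_map homeomorphic_imp_open_map)

text \<open>For injective \<open>p\<close>, the image of a set under \<open>h\<close> is the preimage under \<open>p\<close> of its image under
  \<open>p \<circ> h\<close>, so openness of \<open>h\<close> can be tested after composition with a continuous injection.\<close>

lemma top_mor_left_factor:
  assumes "top_mor op T Z (\<lambda>t. p (h t))" "continuous_map T Y h" "continuous_map Y Z p"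
    and "inj_on p (topspace Y)"
  shows "top_mor op T Y h"
  unfolding top_mor_def
proof (intro conjI impI)
  assume op
  show "open_map T Y h"
    unfolding open_map_def
  proof (intro allI impI)
    fix W assume W: "openin T W"
    then have "openin Z ((\<lambda>t. p (h t)) ` W)"
      using assms(1) \<open>op\<close> by (auto simp: top_mor_def open_map_def)
    then have "openin Y {y \<in> topspace Y. p y \<in> (\<lambda>t. p (h t)) ` W}"
      by (rule openin_continuous_map_preimage[OF assms(3)])
    moreover have "{y \<in> topspace Y. p y \<in> (\<lambda>t. p (h t)) ` W} = h ` W"
    proof -
      have h: "h t \<in> topspace Y" if "t \<in> W" for t
        using continuous_map_funspace[OF assms(2)] openin_subset[OF W] that by blast
      then show ?thesis using inj_onD[OF assms(4)] by blast
    qed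
    ultimately show "openin Y (h ` W)" by simp
  qed
qed (fact assms(2))

section \<open>The index category\<close>

text \<open>The indices that occur in a class of words determine its position in \<open>Gl I\<close>: arrows are the
  inclusions between sets of indices. In particular \<open>[i, i, j]\<close> and \<open>[i, j]\<close> are, for \<open>i \<noteq> j\<close>,
  different but isomorphic objects.\<close>

definition letters :: "'i gl_word set \<Rightarrow> 'i set" where
  "letters a = (\<Union>w\<in>a. set_gl_word w)"

lemma gl_equiv_set_gl_word: "(v, w) \<in> gl_equiv I \<Longrightarrow> set_gl_word v = set_gl_word w"
  by (induction rule: gl_equiv.induct) auto

lemma letters_class: "w \<in> gl_words I \<Longrightarrow> letters (gl_equiv I `` {w}) = set_gl_word w"
  unfolding letters_def by (auto dest: gl_equiv_set_gl_word intro: gl_equiv.refl)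

lemma letters_gl:
  "i \<in> I \<Longrightarrow> letters (gl1 I i) = {i}"
  "i \<in> I \<Longrightarrow> j \<in> I \<Longrightarrow> letters (gl2 I i j) = {i, j}"
  "i \<in> I \<Longrightarrow> j \<in> I \<Longrightarrow> k \<in> I \<Longrightarrow> letters (gl3 I i j k) = {i, j, k}"
  unfolding gl1_def gl2_def gl3_def by (subst letters_class; auto simp: gl_words_def)+

lemma gl_class_eq: "(v, w) \<in> gl_equiv I \<Longrightarrow> gl_equiv I `` {v} = gl_equiv I `` {w}"
  by (rule equiv_class_eq[OF equiv_gl_equiv])

lemma gl2_diag: "i \<in> I \<Longrightarrow> gl2 I i i = gl1 I i"
  unfolding gl1_def gl2_def by (rule gl_class_eq[symmetric]) (rule gl_equiv.diag)

lemma gl3_swap: "i \<in> I \<Longrightarrow> j \<in> I \<Longrightarrow> k \<in> I \<Longrightarrow> gl3 I i j k = gl3 I i k j"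
  unfolding gl3_def by (rule gl_class_eq) (rule gl_equiv.swap)

lemma gl3_dupl: "i \<in> I \<Longrightarrow> j \<in> I \<Longrightarrow> gl3 I i j j = gl2 I i j"
  unfolding gl3_def gl2_def by (rule gl_class_eq) (rule gl_equiv.dupl)

lemma Ob_Gl: "Ob (Gl I) = gl_words I // gl_equiv I"
  by (simp add: Gl_def)

lemma gl_in_Ob:
  "i \<in> I \<Longrightarrow> gl1 I i \<in> Ob (Gl I)"
  "i \<in> I \<Longrightarrow> j \<in> I \<Longrightarrow> gl2 I i j \<in> Ob (Gl I)"
  "i \<in> I \<Longrightarrow> j \<in> I \<Longrightarrow> k \<in> I \<Longrightarrow> gl3 I i j k \<in> Ob (Gl I)"
  unfolding Ob_Gl gl1_def gl2_def gl3_def by (rule quotientI; auto simp: gl_words_def)+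

text \<open>Degenerate triples account for the shorter words.\<close>

lemma Ob_Gl_cases:
  assumes "a \<in> Ob (Gl I)"
  obtains i j k where "i \<in> I" "j \<in> I" "k \<in> I" "a = gl3 I i j k"
proof -
  from assms obtain w where w: "w \<in> gl_words I" and a: "a = gl_equiv I `` {w}"
    unfolding Ob_Gl by (elim quotientE)
  from w consider i where "i \<in> I" "w = One i" | i j where "i \<in> I" "j \<in> I" "w = Two i j"
    | i j k where "i \<in> I" "j \<in> I" "k \<in> I" "w = Three i j k"
    unfolding gl_words_def by blast
  then show ?thesis
  proof cases
    case 1
    then show ?thesis using that[of i i i] a by (simp add: gl3_dupl gl2_diag) (simp add: gl1_def)
  next
    case 2
    then show ?thesis using that[of i j j] a by (simp add: gl3_dupl) (simp add: gl2_def)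
  next
    case 3
    then show ?thesis using that[of i j k] a by (simp add: gl3_def)
  qed
qed

lemma letters_subset: "a \<in> Ob (Gl I) \<Longrightarrow> letters a \<subseteq> I"
  by (erule Ob_Gl_cases) (auto simp: letters_gl)

lemma letters_nonempty: "a \<in> Ob (Gl I) \<Longrightarrow> letters a \<noteq> {}"
  by (erule Ob_Gl_cases) (auto simp: letters_gl)

lemma finite_letters: "a \<in> Ob (Gl I) \<Longrightarrow> finite (letters a)"
  by (erule Ob_Gl_cases) (auto simp: letters_gl)

lemma gl_arrow_Ob: "gl_arrow I a b \<Longrightarrow> a \<in> Ob (Gl I) \<and> b \<in> Ob (Gl I)"
  by (induction rule: gl_arrow.induct) (auto simp: gl_in_Ob, simp_all add: Ob_Gl)

lemma gl_arrow_letters: "gl_arrow I a b \<Longrightarrow> letters a \<subseteq> letters b"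
  by (induction rule: gl_arrow.induct) (auto simp: letters_gl)

lemma Hom_Gl: "m \<in> Hom (Gl I) a b \<longleftrightarrow> gl_arrow I a b"
  by (simp add: Gl_def)

text \<open>A triple can be reordered at will: \<open>gl3_swap\<close> exchanges its last two entries, \<open>tau3\<close> the first
  two.\<close>

lemma gl_arrow_from_gl2:
  assumes a: "a \<in> Ob (Gl I)" and ij: "i \<in> letters a" "j \<in> letters a"
  shows "gl_arrow I (gl2 I i j) a"
proof -
  obtain p q r where I: "p \<in> I" "q \<in> I" "r \<in> I" and a_eq: "a = gl3 I p q r"
    using a by (rule Ob_Gl_cases)
  have first: "gl_arrow I (gl2 I x n) (gl3 I x y z)"
    if "x \<in> I" "y \<in> I" "z \<in> I" "n \<in> {x, y, z}" for x y z n
  proof (cases "n = x")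
    case True
    have "gl_arrow I (gl1 I x) (gl3 I x y z)"
      using gl_arrow.comp[OF gl_arrow.eta2[of x I y] gl_arrow.eta3[of x I y z y]] that by simp
    then show ?thesis using True that(1) by (simp add: gl2_diag)
  next
    case False
    then show ?thesis using that by (auto intro: gl_arrow.eta3)
  qed
  have second: "gl_arrow I (gl2 I q n) a" if "n \<in> {p, q, r}" for n
    using gl_arrow.comp[OF first[of q p r n] gl_arrow.tau3[of p I q r]] that I unfolding a_eq
    by blast
  have third: "gl_arrow I (gl2 I r n) a" if "n \<in> {p, q, r}" for n
    using gl_arrow.comp[OF first[of r p q n] gl_arrow.tau3[of p I r q]] that I
    unfolding a_eq gl3_swap[OF I] by blast
  show ?thesis
    using ij first[of p q r j] second[of j] third[of j] I by (auto simp: a_eq letters_gl)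
qed

lemma gl_arrow_from_gl1: "a \<in> Ob (Gl I) \<Longrightarrow> i \<in> letters a \<Longrightarrow> gl_arrow I (gl1 I i) a"
  using gl_arrow_from_gl2[of a I i i] letters_subset[of a I] by (auto simp: gl2_diag)

section \<open>Limits over the index category\<close>

text \<open>Factorisations through a limit are carried along the isomorphism, so a glued-up object satisfies
  the universal property itself.\<close>

lemma is_glued_up_imp_is_limit:
  assumes C: "is_category C" and G: "is_functor J C G" and glued: "is_glued_up J C G L p"
  shows "is_limit J C G L p"
proof -
  obtain P q h where cone: "is_cone J C G L p" and lim: "is_limit J C G P q" and iso: "is_iso C L P h"
    and h: "\<And>a. a \<in> Ob J \<Longrightarrow> Comp C L P (fob G a) (q a) h = p a"
    using glued unfolding is_glued_up_def by blast
  obtain g where g: "g \<in> Hom C P L" "Comp C L P L g h = Id C L" "Comp C P L P h g = Id C P"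
    and hH: "h \<in> Hom C L P"
    using iso unfolding is_iso_def by blast
  have LO: "L \<in> Ob C" and PO: "P \<in> Ob C" and qH: "\<And>a. a \<in> Ob J \<Longrightarrow> q a \<in> Hom C P (fob G a)"
    and pH: "\<And>a. a \<in> Ob J \<Longrightarrow> p a \<in> Hom C L (fob G a)"
    using cone lim unfolding is_limit_def is_cone_def by blast+
  have GO: "\<And>a. a \<in> Ob J \<Longrightarrow> fob G a \<in> Ob C" using G unfolding is_functor_def by blast
  have assoc: "Comp C a c d w (Comp C a b c v u) = Comp C a b d (Comp C b c d w v) u"
    if "a \<in> Ob C" "b \<in> Ob C" "c \<in> Ob C" "d \<in> Ob C" "u \<in> Hom C a b" "v \<in> Hom C b c" "w \<in> Hom C c d"
    for a b c d u v w
    using C that unfolding is_category_def by blast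
  have compH: "Comp C a b c v u \<in> Hom C a c"
    if "a \<in> Ob C" "b \<in> Ob C" "c \<in> Ob C" "u \<in> Hom C a b" "v \<in> Hom C b c" for a b c u v
    using C that unfolding is_category_def by blast
  have idl: "Comp C a b b (Id C b) u = u" and idr: "Comp C a a b u (Id C a) = u"
    if "a \<in> Ob C" "b \<in> Ob C" "u \<in> Hom C a b" for a b u
    using C that unfolding is_category_def by blast+
  have pg: "Comp C P L (fob G a) (p a) g = q a" if "a \<in> Ob J" for a
    using assoc[OF PO LO PO GO[OF that] g(1) hH qH[OF that]] h[OF that] g(3)
      idr[OF PO GO[OF that] qH[OF that]] by simp
  show ?thesis
    unfolding is_limit_def
  proof (intro conjI allI impI)
    fix Y s assume Y: "is_cone J C G Y s"
    then have YO: "Y \<in> Ob C" unfolding is_cone_def by blast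
    obtain u where uH: "u \<in> Hom C Y P" and u: "\<And>a. a \<in> Ob J \<Longrightarrow> Comp C Y P (fob G a) (q a) u = s a"
      and uniq: "\<And>u'. u' \<in> Hom C Y P \<Longrightarrow> \<forall>a\<in>Ob J. Comp C Y P (fob G a) (q a) u' = s a \<Longrightarrow> u' = u"
      using lim Y unfolding is_limit_def by metis
    show "\<exists>!v. v \<in> Hom C Y L \<and> (\<forall>a\<in>Ob J. Comp C Y L (fob G a) (p a) v = s a)"
    proof (rule ex1I, intro conjI ballI)
      show "Comp C Y P L g u \<in> Hom C Y L" using YO PO LO uH g(1) by (rule compH)
      show "Comp C Y L (fob G a) (p a) (Comp C Y P L g u) = s a" if "a \<in> Ob J" for a
        using assoc[OF YO PO LO GO[OF that] uH g(1) pH[OF that]] pg[OF that] u[OF that] by simp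
    next
      fix v assume v: "v \<in> Hom C Y L \<and> (\<forall>a\<in>Ob J. Comp C Y L (fob G a) (p a) v = s a)"
      have "Comp C Y P (fob G a) (q a) (Comp C Y L P h v) = s a" if "a \<in> Ob J" for a
        using assoc[OF YO LO PO GO[OF that] _ hH qH[OF that]] v h[OF that] that by simp
      then have "Comp C Y L P h v = u" using uniq compH[OF YO LO PO _ hH] v by blast
      then show "v = Comp C Y P L g u"
        using assoc[OF YO LO PO LO _ hH g(1), of v] v idl[OF YO LO, of v] g(2) by auto
    qed
  qed (fact cone)
qed

lemma is_limit_imp_is_glued_up:
  assumes C: "is_category C" and G: "is_functor J C G" and lim: "is_limit J C G L p"
  shows "is_glued_up J C G L p"
proof -
  have cone: "is_cone J C G L p" and L: "L \<in> Ob C"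
    using lim unfolding is_limit_def is_cone_def by blast+
  have "is_iso C L L (Id C L)"
    using C L unfolding is_iso_def is_category_def by metis
  moreover have "\<forall>a\<in>Ob J. Comp C L L (fob G a) (p a) (Id C L) = p a"
    using C G cone L unfolding is_cone_def is_category_def is_functor_def by blast
  ultimately show ?thesis using cone lim unfolding is_glued_up_def by blast
qed

text \<open>The leg of the cone at any object \<open>a\<close> is the composite through an arbitrary index in \<open>a\<close>; two
  choices \<open>i\<close> and \<open>j\<close> agree because \<open>[i]\<close> and \<open>[j]\<close> reach \<open>a\<close> through \<open>[i, j]\<close>. So only
  compatibility on each \<open>G [i, j]\<close> is needed.\<close>

lemma Gl_cone_exists:
  assumes C: "is_category C" and G: "is_functor (Gl I) C G" and Y: "Y \<in> Ob C"
    and q: "\<And>i. i \<in> I \<Longrightarrow> q i \<in> Hom C Y (fob G (gl1 I i))"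
    and compat: "\<And>i j. i \<in> I \<Longrightarrow> j \<in> I \<Longrightarrow>
      Comp C Y (fob G (gl1 I i)) (fob G (gl2 I i j)) (fmor G (gl1 I i) (gl2 I i j) ()) (q i) =
      Comp C Y (fob G (gl1 I j)) (fob G (gl2 I i j)) (fmor G (gl1 I j) (gl2 I i j) ()) (q j)"
  obtains p where "is_cone (Gl I) C G Y p" "\<And>i. i \<in> I \<Longrightarrow> p (gl1 I i) = q i"
proof -
  have assoc: "Comp C a c d w (Comp C a b c v u) = Comp C a b d (Comp C b c d w v) u"
    if "a \<in> Ob C" "b \<in> Ob C" "c \<in> Ob C" "d \<in> Ob C" "u \<in> Hom C a b" "v \<in> Hom C b c" "w \<in> Hom C c d"
    for a b c d u v w
    using C that unfolding is_category_def by blast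
  have compH: "Comp C a b c v u \<in> Hom C a c"
    if "a \<in> Ob C" "b \<in> Ob C" "c \<in> Ob C" "u \<in> Hom C a b" "v \<in> Hom C b c" for a b c u v
    using C that unfolding is_category_def by blast
  have GO: "fob G a \<in> Ob C" if "a \<in> Ob (Gl I)" for a
    using G that unfolding is_functor_def by blast
  have GH: "fmor G a b () \<in> Hom C (fob G a) (fob G b)" if "gl_arrow I a b" for a b
    using G gl_arrow_Ob[OF that] that Hom_Gl[of "()" I a b] unfolding is_functor_def by blast
  have Gcomp: "fmor G a c () = Comp C (fob G a) (fob G b) (fob G c) (fmor G b c ()) (fmor G a b ())"
    if "gl_arrow I a b" "gl_arrow I b c" for a b c
  proof -
    have "fmor G a c (Comp (Gl I) a b c () ()) =
        Comp C (fob G a) (fob G b) (fob G c) (fmor G b c ()) (fmor G a b ())"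
      using G gl_arrow_Ob[OF that(1)] gl_arrow_Ob[OF that(2)] that Hom_Gl[of "()"]
      unfolding is_functor_def by blast
    then show ?thesis by (simp add: Gl_def)
  qed
  define leg where
    "leg i a = Comp C Y (fob G (gl1 I i)) (fob G a) (fmor G (gl1 I i) a ()) (q i)" for i a
  have push: "Comp C Y (fob G b) (fob G a) (fmor G b a ()) (leg i b) = leg i a"
    if i: "i \<in> letters b" and ba: "gl_arrow I b a" for i a b
  proof -
    have b: "b \<in> Ob (Gl I)" "a \<in> Ob (Gl I)" using gl_arrow_Ob[OF ba] by auto
    then have iI: "i \<in> I" and ib: "gl_arrow I (gl1 I i) b"
      using letters_subset[OF b(1)] gl_arrow_from_gl1[OF b(1) i] i by auto
    show ?thesis
      unfolding leg_def Gcomp[OF ib ba]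
      by (rule assoc) (use Y GO gl_in_Ob(1)[OF iI] b GH[OF ib] GH[OF ba] q[OF iI] in auto)
  qed
  have indep: "leg i a = leg j a" if a: "a \<in> Ob (Gl I)" and "i \<in> letters a" "j \<in> letters a" for i j a
  proof -
    have I: "i \<in> I" "j \<in> I" using letters_subset that by blast+
    have "leg i (gl2 I i j) = leg j (gl2 I i j)" using compat[OF I] by (simp add: leg_def)
    then show ?thesis
      using push[of i "gl2 I i j" a] push[of j "gl2 I i j" a] gl_arrow_from_gl2[OF that] I
      by (simp add: letters_gl)
  qed
  have G_id: "fmor G a a () = Id C (fob G a)" if "a \<in> Ob (Gl I)" for a
  proof -
    have "fmor G a a (Id (Gl I) a) = Id C (fob G a)" using G that unfolding is_functor_def by blast
    then show ?thesis by (simp add: Gl_def)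
  qed
  have leg_gl1: "leg i (gl1 I i) = q i" if "i \<in> I" for i
    using C G_id[OF gl_in_Ob(1)[OF that]] q[OF that] Y GO[OF gl_in_Ob(1)[OF that]]
    unfolding is_category_def leg_def by simp
  define p where "p a = leg (SOME i. i \<in> letters a) a" for a
  have p: "p a = leg i a" if "a \<in> Ob (Gl I)" "i \<in> letters a" for a i
    unfolding p_def using that by (intro indep) (auto intro: someI)
  show ?thesis
  proof
    show "is_cone (Gl I) C G Y p"
      unfolding is_cone_def
    proof (intro conjI ballI)
      fix a assume a: "a \<in> Ob (Gl I)"
      obtain i where i: "i \<in> letters a" using letters_nonempty[OF a] by blast
      have iI: "i \<in> I" using letters_subset[OF a] i by blast
      show "p a \<in> Hom C Y (fob G a)"
        unfolding p[OF a i] leg_def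
        by (rule compH) (use Y GO a gl_in_Ob(1)[OF iI] q[OF iI] GH gl_arrow_from_gl1[OF a i] in auto)
    next
      fix a b m assume a: "a \<in> Ob (Gl I)" and b: "b \<in> Ob (Gl I)" and m: "m \<in> Hom (Gl I) a b"
      obtain i where i: "i \<in> letters a" using letters_nonempty[OF a] by blast
      have ab: "gl_arrow I a b" using m by (simp add: Hom_Gl)
      then show "Comp C Y (fob G a) (fob G b) (fmor G a b m) (p a) = p b"
        using p[OF a i] p[OF b, of i] push[OF i ab] gl_arrow_letters[OF ab] i by auto
    qed (fact Y)
    show "p (gl1 I i) = q i" if "i \<in> I" for i
      using p[OF gl_in_Ob(1)[OF that], of i] leg_gl1[OF that] by (simp add: letters_gl that)
  qed
qed

text \<open>Conversely, every object receives an arrow from some \<open>[i]\<close>, so the legs at these determine a cone.\<close>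

lemma Gl_cone_leg:
  assumes "is_cone (Gl I) C G Y p" "a \<in> Ob (Gl I)" "i \<in> letters a"
  shows "p a = Comp C Y (fob G (gl1 I i)) (fob G a) (fmor G (gl1 I i) a ()) (p (gl1 I i))"
proof -
  have "gl_arrow I (gl1 I i) a" using assms by (intro gl_arrow_from_gl1)
  then show ?thesis
    using assms(1) gl_arrow_Ob[of I "gl1 I i" a] Hom_Gl[of "()" I "gl1 I i" a]
    unfolding is_cone_def by metis
qed

text \<open>Cones and compatible families indexed by \<open>I\<close> being the same thing, the universal property can be
  used and verified for such families, without mentioning longer words.\<close>

lemma is_limit_Gl_iff:
  assumes C: "is_category C" and G: "is_functor (Gl I) C G"
  shows "is_limit (Gl I) C G L p \<longleftrightarrow> is_cone (Gl I) C G L p \<and>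
    (\<forall>Y\<in>Ob C. \<forall>q. (\<forall>i\<in>I. q i \<in> Hom C Y (fob G (gl1 I i))) \<longrightarrow>
      (\<forall>i\<in>I. \<forall>j\<in>I.
        Comp C Y (fob G (gl1 I i)) (fob G (gl2 I i j)) (fmor G (gl1 I i) (gl2 I i j) ()) (q i) =
        Comp C Y (fob G (gl1 I j)) (fob G (gl2 I i j)) (fmor G (gl1 I j) (gl2 I i j) ()) (q j)) \<longrightarrow>
      (\<exists>!h. h \<in> Hom C Y L \<and> (\<forall>i\<in>I. Comp C Y L (fob G (gl1 I i)) (p (gl1 I i)) h = q i)))"
    (is "_ \<longleftrightarrow> _ \<and> ?univ")
proof (cases "is_cone (Gl I) C G L p")
  case cone: True
  then have L: "L \<in> Ob C" and pH: "\<And>a. a \<in> Ob (Gl I) \<Longrightarrow> p a \<in> Hom C L (fob G a)"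
    unfolding is_cone_def by blast+
  have GO: "fob G a \<in> Ob C" if "a \<in> Ob (Gl I)" for a
    using G that unfolding is_functor_def by blast
  have factor_iff: "(\<forall>a\<in>Ob (Gl I). Comp C Y L (fob G a) (p a) h = r a) \<longleftrightarrow>
      (\<forall>i\<in>I. Comp C Y L (fob G (gl1 I i)) (p (gl1 I i)) h = r (gl1 I i))"
    if r: "is_cone (Gl I) C G Y r" and h: "h \<in> Hom C Y L" for Y r h
  proof (intro iffI ballI)
    fix a assume a: "a \<in> Ob (Gl I)"
      and hi: "\<forall>i\<in>I. Comp C Y L (fob G (gl1 I i)) (p (gl1 I i)) h = r (gl1 I i)"
    obtain i where i: "i \<in> letters a" using letters_nonempty[OF a] by blast
    then have iI: "i \<in> I" using letters_subset[OF a] by blast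
    have Y: "Y \<in> Ob C" using r unfolding is_cone_def by blast
    have "fmor G (gl1 I i) a () \<in> Hom C (fob G (gl1 I i)) (fob G a)"
      using G a gl_in_Ob(1)[OF iI] gl_arrow_from_gl1[OF a i] Hom_Gl[of "()" I "gl1 I i" a]
      unfolding is_functor_def by blast
    then show "Comp C Y L (fob G a) (p a) h = r a"
      unfolding Gl_cone_leg[OF r a i] Gl_cone_leg[OF cone a i]
      using hi iI C Y L h GO[OF a] GO[OF gl_in_Ob(1)[OF iI]] pH[OF gl_in_Ob(1)[OF iI]]
      unfolding is_category_def by metis
  qed (auto simp: gl_in_Ob)
  show ?thesis
  proof (intro iffI conjI cone)
    assume lim: "is_limit (Gl I) C G L p"
    show ?univ
    proof (intro ballI allI impI)
      fix Y q assume Y: "Y \<in> Ob C" "\<forall>i\<in>I. q i \<in> Hom C Y (fob G (gl1 I i))"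
        "\<forall>i\<in>I. \<forall>j\<in>I.
          Comp C Y (fob G (gl1 I i)) (fob G (gl2 I i j)) (fmor G (gl1 I i) (gl2 I i j) ()) (q i) =
          Comp C Y (fob G (gl1 I j)) (fob G (gl2 I i j)) (fmor G (gl1 I j) (gl2 I i j) ()) (q j)"
      then obtain r where r: "is_cone (Gl I) C G Y r" "\<And>i. i \<in> I \<Longrightarrow> r (gl1 I i) = q i"
        using Gl_cone_exists[OF C G Y(1), of q] by metis
      have "(h \<in> Hom C Y L \<and> (\<forall>i\<in>I. Comp C Y L (fob G (gl1 I i)) (p (gl1 I i)) h = q i)) \<longleftrightarrow>
          (h \<in> Hom C Y L \<and> (\<forall>a\<in>Ob (Gl I). Comp C Y L (fob G a) (p a) h = r a))" for h
        using factor_iff[OF r(1), of h] r(2) by auto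
      then show "\<exists>!h. h \<in> Hom C Y L \<and>
          (\<forall>i\<in>I. Comp C Y L (fob G (gl1 I i)) (p (gl1 I i)) h = q i)"
        using lim r(1) unfolding is_limit_def by simp
    qed
  next
    assume "is_cone (Gl I) C G L p \<and> ?univ"
    then have univ: ?univ by blast
    show "is_limit (Gl I) C G L p"
      unfolding is_limit_def
    proof (intro conjI allI impI)
      fix Y r assume r: "is_cone (Gl I) C G Y r"
      have "\<exists>!h. h \<in> Hom C Y L \<and>
          (\<forall>i\<in>I. Comp C Y L (fob G (gl1 I i)) (p (gl1 I i)) h = r (gl1 I i))"
      proof (rule univ[rule_format])
        show "Y \<in> Ob C" using r unfolding is_cone_def by blast
        show "r (gl1 I i) \<in> Hom C Y (fob G (gl1 I i))" if "i \<in> I" for i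
          using r gl_in_Ob(1)[OF that] unfolding is_cone_def by blast
        show "Comp C Y (fob G (gl1 I i)) (fob G (gl2 I i j)) (fmor G (gl1 I i) (gl2 I i j) ()) (r (gl1 I i)) =
            Comp C Y (fob G (gl1 I j)) (fob G (gl2 I i j)) (fmor G (gl1 I j) (gl2 I i j) ()) (r (gl1 I j))"
          if "i \<in> I" "j \<in> I" for i j
          using Gl_cone_leg[OF r gl_in_Ob(2)[OF that], of i]
            Gl_cone_leg[OF r gl_in_Ob(2)[OF that], of j] by (simp add: letters_gl that)
      qed
      moreover have "(h \<in> Hom C Y L \<and> (\<forall>i\<in>I. Comp C Y L (fob G (gl1 I i)) (p (gl1 I i)) h = r (gl1 I i))) \<longleftrightarrow>
          (h \<in> Hom C Y L \<and> (\<forall>a\<in>Ob (Gl I). Comp C Y L (fob G a) (p a) h = r a))" for h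
        using factor_iff[OF r, of h] by auto
      ultimately show "\<exists>!h. h \<in> Hom C Y L \<and> (\<forall>a\<in>Ob (Gl I). Comp C Y L (fob G a) (p a) h = r a)"
        by simp
    qed (fact cone)
  qed
qed (simp add: is_limit_def)

section \<open>Auxiliary spaces inside the universe\<close>

text \<open>The universal properties only speak of spaces carried by the type \<open>'u\<close>. The two spaces used as
  test objects, a fibre product and a quotient of a disjoint union, have to be copied into \<open>'u\<close>;
  this is where \<open>'u\<close> has to be infinite and at least as large as the index set.\<close>

lemma lepoll_times_universe:
  assumes "infinite (UNIV :: 'u set)" "A \<lesssim> (UNIV :: 'u set)"
  shows "A \<times> (UNIV :: 'u set) \<lesssim> (UNIV :: 'u set)"
proof -
  have "A \<times> (UNIV :: 'u set) \<lesssim> (UNIV :: 'u set) \<times> (UNIV :: 'u set)"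
    using assms(2) by (intro times_lepoll_mono) auto
  also have "(UNIV :: 'u set) \<times> (UNIV :: 'u set) \<approx> (UNIV :: 'u set)"
    unfolding eqpoll_iff_card_of_ordIso by (rule card_of_Times_same_infinite) (fact assms(1))
  finally show ?thesis .
qed

lemma homeomorphic_copy_exists:
  fixes T :: "'b topology"
  assumes "(UNIV :: 'b set) \<lesssim> (UNIV :: 'u set)"
  obtains Y :: "'u topology" and c d where "homeomorphic_maps T Y c d"
proof -
  obtain c :: "'b \<Rightarrow> 'u" where c: "inj c" using assms unfolding lepoll_def by blast
  let ?Y = "pullback_topology (range c) (inv c) T"
  have id: "inv c \<circ> c = id" using c by simp
  have "continuous_map T ?Y c"
    by (rule continuous_map_pullback') (auto simp: id continuous_map_id)
  moreover have "continuous_map ?Y T (inv c)"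
    using continuous_map_pullback[OF continuous_map_id, of "range c" "inv c" T] by (simp add: o_def)
  ultimately show ?thesis
    using that[of ?Y c "inv c"] c
    by (auto simp: homeomorphic_maps_def topspace_pullback_topology f_inv_into_f)
qed

lemma final_topology_exists:
  obtains Q where "topspace Q = (\<Union>i\<in>I. \<kappa> i ` topspace (X i))" "final_topology I Q X \<kappa>"
proof -
  let ?T = "\<Union>i\<in>I. \<kappa> i ` topspace (X i)"
  let ?P = "\<lambda>V. V \<subseteq> ?T \<and> (\<forall>i\<in>I. openin (X i) {x \<in> topspace (X i). \<kappa> i x \<in> V})"
  have ist: "istopology ?P"
    unfolding istopology_def
  proof (intro conjI allI impI)
    fix V W assume "?P V" "?P W"
    moreover have "{x \<in> topspace (X i). \<kappa> i x \<in> V \<inter> W} =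
      {x \<in> topspace (X i). \<kappa> i x \<in> V} \<inter> {x \<in> topspace (X i). \<kappa> i x \<in> W}" for i by auto
    ultimately show "V \<inter> W \<subseteq> ?T" "\<forall>i\<in>I. openin (X i) {x \<in> topspace (X i). \<kappa> i x \<in> V \<inter> W}"
      by auto
  next
    fix K assume K: "\<forall>V\<in>K. ?P V"
    moreover have "{x \<in> topspace (X i). \<kappa> i x \<in> \<Union>K} =
      (\<Union>V\<in>K. {x \<in> topspace (X i). \<kappa> i x \<in> V})" for i by auto
    ultimately show "\<Union>K \<subseteq> ?T" "\<forall>i\<in>I. openin (X i) {x \<in> topspace (X i). \<kappa> i x \<in> \<Union>K}"
      by auto
  qed
  have openin: "openin (topology ?P) V \<longleftrightarrow> ?P V" for V
    by (simp add: topology_inverse'[OF ist])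
  have "{x \<in> topspace (X i). \<kappa> i x \<in> ?T} = topspace (X i)" if "i \<in> I" for i
    using that by auto
  then have T: "openin (topology ?P) ?T" unfolding openin by simp
  have top: "topspace (topology ?P) = ?T"
  proof (rule subset_antisym)
    show "topspace (topology ?P) \<subseteq> ?T"
      using openin[THEN iffD1, OF openin_topspace] by blast
  qed (rule openin_subset[OF T])
  show ?thesis
    by (rule that[OF top]) (simp add: final_topology_def top openin)
qed

lemma final_topology_continuous_iff:
  assumes "final_topology I Q X \<kappa>" "\<And>i. i \<in> I \<Longrightarrow> \<kappa> i \<in> topspace (X i) \<rightarrow> topspace Q"
    and "f \<in> topspace Q \<rightarrow> topspace Y"
  shows "continuous_map Q Y f \<longleftrightarrow> (\<forall>i\<in>I. continuous_map (X i) Y (\<lambda>x. f (\<kappa> i x)))"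
proof -
  have "{x \<in> topspace (X i). \<kappa> i x \<in> {y \<in> topspace Q. f y \<in> V}} =
      {x \<in> topspace (X i). f (\<kappa> i x) \<in> V}" if "i \<in> I" for i V
    using assms(2)[OF that] by auto
  moreover have "(\<lambda>x. f (\<kappa> i x)) \<in> topspace (X i) \<rightarrow> topspace Y" if "i \<in> I" for i
    using assms(2)[OF that] assms(3) by auto
  ultimately show ?thesis
    using assms(1,3) unfolding continuous_map final_topology_def by (auto simp: image_subset_iff_funcset)
qed

text \<open>Open maps are stable under base change, so the fibre product of two open maps is also a cone in
  \<open>oTop\<close>.\<close>

lemma pullback_space_mor:
  assumes f: "top_mor op A C f" and g: "top_mor op B C g"
  shows "top_mor op (pullback_space A B f g) A fst" "top_mor op (pullback_space A B f g) B snd"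
proof -
  have cont: "continuous_map (pullback_space A B f g) A fst" "continuous_map (pullback_space A B f g) B snd"
    unfolding pullback_space_def
    by (auto intro!: continuous_map_from_subtopology continuous_map_fst continuous_map_snd)
  have open_fst: "open_map (pullback_space A B f g) A fst"
    if f: "continuous_map A C f" and g: "open_map B C g" for A :: "'x topology" and B :: "'y topology" and f g
    unfolding open_map_def
  proof (intro allI impI)
    fix W assume "openin (pullback_space A B f g) W"
    then obtain N where N: "openin (prod_topology A B) N" and W: "W = N \<inter> {(x, y). f x = g y}"
      unfolding pullback_space_def openin_subtopology by blast
    show "openin A (fst ` W)"
    proof (subst openin_subopen, intro ballI)
      fix x assume "x \<in> fst ` W"
      then obtain y where y: "(x, y) \<in> N" "f x = g y" unfolding W by auto
      then obtain P R where PR: "openin A P" "openin B R" "x \<in> P" "y \<in> R" "P \<times> R \<subseteq> N"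
        using N unfolding openin_prod_topology_alt by metis
      let ?T = "P \<inter> {x \<in> topspace A. f x \<in> g ` R}"
      have "openin A ?T"
        using PR(1,2) f g by (auto simp: open_map_def intro!: openin_continuous_map_preimage[of A C f])
      moreover have "x \<in> ?T" using PR openin_subset[OF PR(1)] y(2) by auto
      moreover have "?T \<subseteq> fst ` W" unfolding W using PR(5) by force
      ultimately show "\<exists>T. openin A T \<and> x \<in> T \<and> T \<subseteq> fst ` W" by blast
    qed
  qed
  have open_snd: "open_map (pullback_space A B f g) B snd"
    if f: "open_map A C f" and g: "continuous_map B C g"
    unfolding open_map_def
  proof (intro allI impI)
    fix W assume "openin (pullback_space A B f g) W"
    then obtain N where N: "openin (prod_topology A B) N" and W: "W = N \<inter> {(x, y). f x = g y}"
      unfolding pullback_space_def openin_subtopology by blast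
    show "openin B (snd ` W)"
    proof (subst openin_subopen, intro ballI)
      fix y assume "y \<in> snd ` W"
      then obtain x where x: "(x, y) \<in> N" "f x = g y" unfolding W by auto
      then obtain P R where PR: "openin A P" "openin B R" "x \<in> P" "y \<in> R" "P \<times> R \<subseteq> N"
        using N unfolding openin_prod_topology_alt by metis
      let ?T = "R \<inter> {y \<in> topspace B. g y \<in> f ` P}"
      have "openin B ?T"
        using PR(1,2) f g by (auto simp: open_map_def intro!: openin_continuous_map_preimage[of B C g])
      moreover have "y \<in> ?T" using PR openin_subset[OF PR(2)] x(2) by (auto simp: rev_image_eqI)
      moreover have "?T \<subseteq> snd ` W" unfolding W using PR(5) by force
      ultimately show "\<exists>T. openin B T \<and> y \<in> T \<and> T \<subseteq> snd ` W" by blast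
    qed
  qed
  show "top_mor op (pullback_space A B f g) A fst" "top_mor op (pullback_space A B f g) B snd"
    using cont open_fst open_snd f g unfolding top_mor_def by auto
qed

section \<open>From a functor to a covering\<close>

locale space_gluing =
  fixes op :: bool and I :: "'i set" and G :: "('i gl_word set, unit, 'u topology, 'u \<Rightarrow> 'u) fctr"
  assumes gluing: "gluing_data_functor (op_cat (top_cat op)) I G"
begin

abbreviation S :: "'i gl_word set \<Rightarrow> 'u topology" where "S \<equiv> fob G"
abbreviation M :: "'i gl_word set \<Rightarrow> 'i gl_word set \<Rightarrow> 'u \<Rightarrow> 'u" where "M a b \<equiv> fmor G a b ()"

lemma G_functor: "is_functor (Gl I) (op_cat (top_cat op)) G"
  using gluing unfolding gluing_data_functor_def by blast

lemma M_mor: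
  assumes "gl_arrow I a b"
  shows "top_mor op (S b) (S a) (M a b)" "M a b \<in> extensional (topspace (S b))"
proof -
  have "M a b \<in> Hom (op_cat (top_cat op)) (S a) (S b)"
    using G_functor gl_arrow_Ob[OF assms] assms Hom_Gl[of "()" I a b] unfolding is_functor_def by blast
  then show "top_mor op (S b) (S a) (M a b)" "M a b \<in> extensional (topspace (S b))"
    by (simp_all add: op_cat_simps top_cat_simps)
qed

lemma M_in: "gl_arrow I a b \<Longrightarrow> z \<in> topspace (S b) \<Longrightarrow> M a b z \<in> topspace (S a)"
  using M_mor(1) top_mor_funcset by blast

lemma M_comp:
  assumes "gl_arrow I a b" "gl_arrow I b c" "z \<in> topspace (S c)"
  shows "M a b (M b c z) = M a c z"
proof -
  have "fmor G a c (Comp (Gl I) a b c () ()) = Comp (op_cat (top_cat op)) (S a) (S b) (S c) (M b c) (M a b)"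
    using G_functor gl_arrow_Ob[OF assms(1)] gl_arrow_Ob[OF assms(2)] assms Hom_Gl[of "()"]
    unfolding is_functor_def by blast
  then show ?thesis using assms(3) by (simp add: Gl_def op_cat_simps top_cat_simps compose_def)
qed

lemma M_id:
  assumes "a \<in> Ob (Gl I)" "z \<in> topspace (S a)"
  shows "M a a z = z"
proof -
  have "fmor G a a (Id (Gl I) a) = Id (op_cat (top_cat op)) (S a)"
    using G_functor assms unfolding is_functor_def by blast
  then show ?thesis using assms(2) by (simp add: Gl_def op_cat_simps top_cat_simps)
qed

text \<open>The topological fibre product is a cone in \<open>Top\<close> and in \<open>oTop\<close>, so it maps to the pullback that the
  universal property provides, and each of its points lifts.\<close>

lemma triple_overlap_point:
  assumes inf: "infinite (UNIV :: 'u set)" and I: "i \<in> I" "j \<in> I" "k \<in> I"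
    and a: "a \<in> topspace (S (gl2 I i j))" and b: "b \<in> topspace (S (gl2 I i k))"
    and eq: "M (gl1 I i) (gl2 I i j) a = M (gl1 I i) (gl2 I i k) b"
  shows "\<exists>z\<in>topspace (S (gl3 I i j k)). M (gl2 I i j) (gl3 I i j k) z = a \<and> M (gl2 I i k) (gl3 I i j k) z = b"
proof -
  let ?A = "S (gl2 I i j)" and ?B = "S (gl2 I i k)"
  let ?f = "M (gl1 I i) (gl2 I i j)" and ?g = "M (gl1 I i) (gl2 I i k)"
  let ?P = "pullback_space ?A ?B ?f ?g"
  have "(UNIV :: ('u \<times> 'u) set) \<lesssim> (UNIV :: 'u set)"
    using lepoll_times_universe[OF inf, of "UNIV :: 'u set"] by simp
  then obtain Y :: "'u topology" and c d where Y: "homeomorphic_maps ?P Y c d"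
    by (rule homeomorphic_copy_exists)
  then have d: "top_mor op Y ?P d" using homeomorphic_maps_top_mor by blast
  let ?r = "restrict (fst \<circ> d) (topspace Y)" and ?s = "restrict (snd \<circ> d) (topspace Y)"
  have fg: "top_mor op ?A (S (gl1 I i)) ?f" "top_mor op ?B (S (gl1 I i)) ?g"
    using I by (auto intro: M_mor gl_arrow.eta2)
  have rs: "top_mor op Y ?A (fst \<circ> d)" "top_mor op Y ?B (snd \<circ> d)"
    using top_mor_compose[OF d] pullback_space_mor[OF fg] by blast+
  have "d y \<in> topspace ?P" if "y \<in> topspace Y" for y
    using top_mor_funcset[OF d] that by blast
  then have rs_eq: "?f (fst (d y)) = ?g (snd (d y))" if "y \<in> topspace Y" for y
    using that unfolding pullback_space_def by fastforce
  have "is_pushout (op_cat (top_cat op)) (S (gl1 I i)) ?A ?B ?f ?g (S (gl3 I i j k))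
      (M (gl2 I i j) (gl3 I i j k)) (M (gl2 I i k) (gl3 I i j k))"
    using gluing I unfolding gluing_data_functor_def by blast
  moreover have "?r \<in> Hom (op_cat (top_cat op)) ?A Y" "?s \<in> Hom (op_cat (top_cat op)) ?B Y"
    using rs by (simp_all add: op_cat_simps top_cat_simps top_mor_restrict)
  moreover have "Comp (op_cat (top_cat op)) (S (gl1 I i)) ?A Y ?r ?f =
      Comp (op_cat (top_cat op)) (S (gl1 I i)) ?B Y ?s ?g"
    using rs_eq by (auto simp: op_cat_simps top_cat_simps compose_def)
  moreover have "Y \<in> Ob (op_cat (top_cat op))" by (simp add: op_cat_simps top_cat_simps)
  ultimately obtain h where h: "h \<in> Hom (op_cat (top_cat op)) (S (gl3 I i j k)) Y"
      "Comp (op_cat (top_cat op)) ?A (S (gl3 I i j k)) Y h (M (gl2 I i j) (gl3 I i j k)) = ?r"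
      "Comp (op_cat (top_cat op)) ?B (S (gl3 I i j k)) Y h (M (gl2 I i k) (gl3 I i j k)) = ?s"
    unfolding is_pushout_def by metis
  have ab: "(a, b) \<in> topspace ?P" using a b eq by (simp add: pullback_space_def)
  define y where "y = c (a, b)"
  have y: "y \<in> topspace Y" and dy: "d y = (a, b)"
    using Y ab unfolding y_def homeomorphic_maps_def by (auto dest: continuous_map_funspace)
  have "h y \<in> topspace (S (gl3 I i j k))"
    using h(1) y top_mor_funcset by (fastforce simp: op_cat_simps top_cat_simps)
  moreover have "M (gl2 I i j) (gl3 I i j k) (h y) = a" "M (gl2 I i k) (gl3 I i j k) (h y) = b"
    using fun_cong[OF h(2), of y] fun_cong[OF h(3), of y] y dy
    by (simp_all add: op_cat_simps top_cat_simps compose_def)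
  ultimately show ?thesis by blast
qed

text \<open>The identifications that \<open>G\<close> prescribes between points of the pieces.\<close>

definition glue_rel :: "('i \<times> 'u) rel" where
  "glue_rel = {((i, x), (j, y)). i \<in> I \<and> j \<in> I \<and> (\<exists>z\<in>topspace (S (gl2 I i j)).
     M (gl1 I i) (gl2 I i j) z = x \<and> M (gl1 I j) (gl2 I i j) z = y)}"

lemma gl1_arrow_gl2: "i \<in> I \<Longrightarrow> j \<in> I \<Longrightarrow> gl_arrow I (gl1 I i) (gl2 I i j) \<and> gl_arrow I (gl1 I j) (gl2 I i j)"
  by (simp add: gl_arrow_from_gl1 gl_in_Ob letters_gl)

text \<open>Transitivity is the cocycle condition: two identifications through \<open>j\<close> meet in a point of
  \<open>G [j, i, k]\<close>, which maps to \<open>G [i, k]\<close>.\<close>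

lemma equiv_glue_rel:
  assumes inf: "infinite (UNIV :: 'u set)"
  shows "equiv (SIGMA i:I. topspace (S (gl1 I i))) glue_rel"
proof (rule equivI)
  show "glue_rel \<subseteq> (SIGMA i:I. topspace (S (gl1 I i))) \<times> (SIGMA i:I. topspace (S (gl1 I i)))"
    unfolding glue_rel_def using gl1_arrow_gl2 M_in by fastforce
  show "refl_on (SIGMA i:I. topspace (S (gl1 I i))) glue_rel"
    unfolding refl_on_def glue_rel_def by (auto simp: gl2_diag M_id gl_in_Ob)
  have tau: "gl_arrow I (gl2 I j i) (gl2 I i j)" if "i \<in> I" "j \<in> I" for i j
    using that by (rule gl_arrow.tau2)
  show "sym glue_rel"
  proof (rule symI, clarify)
    fix i x j y assume "((i, x), (j, y)) \<in> glue_rel"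
    then obtain z where z: "i \<in> I" "j \<in> I" "z \<in> topspace (S (gl2 I i j))"
        "M (gl1 I i) (gl2 I i j) z = x" "M (gl1 I j) (gl2 I i j) z = y"
      unfolding glue_rel_def by blast
    let ?z = "M (gl2 I j i) (gl2 I i j) z"
    have "?z \<in> topspace (S (gl2 I j i))" using M_in tau z by blast
    moreover have "M (gl1 I i) (gl2 I j i) ?z = x" "M (gl1 I j) (gl2 I j i) ?z = y"
      using M_comp[OF _ tau[OF z(1,2)] z(3)] gl1_arrow_gl2[OF z(2,1)] z(4,5) by auto
    ultimately show "((j, y), (i, x)) \<in> glue_rel" using z(1,2) unfolding glue_rel_def by blast
  qed
  then have sym: "(t, s) \<in> glue_rel" if "(s, t) \<in> glue_rel" for s t using that by (rule symD)
  show "trans glue_rel"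
  proof (rule transI, clarify)
    fix i x j y k w assume 1: "((i, x), (j, y)) \<in> glue_rel" and 2: "((j, y), (k, w)) \<in> glue_rel"
    obtain a where a: "i \<in> I" "j \<in> I" "a \<in> topspace (S (gl2 I j i))"
        "M (gl1 I j) (gl2 I j i) a = y" "M (gl1 I i) (gl2 I j i) a = x"
      using sym[OF 1] unfolding glue_rel_def by blast
    obtain b where b: "k \<in> I" "b \<in> topspace (S (gl2 I j k))"
        "M (gl1 I j) (gl2 I j k) b = y" "M (gl1 I k) (gl2 I j k) b = w"
      using 2 unfolding glue_rel_def by blast
    obtain z where z: "z \<in> topspace (S (gl3 I j i k))" "M (gl2 I j i) (gl3 I j i k) z = a"
        "M (gl2 I j k) (gl3 I j i k) z = b"
      using triple_overlap_point[OF inf a(2,1) b(1) a(3) b(2)] a(4) b(3) by auto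
    have arrow: "gl_arrow I (gl2 I p q) (gl3 I j i k)" if "p \<in> {i, j, k}" "q \<in> {i, j, k}" for p q
      using that a(1,2) b(1) by (intro gl_arrow_from_gl2) (auto simp: gl_in_Ob letters_gl)
    have arrow1: "gl_arrow I (gl1 I p) (gl2 I p q)" "gl_arrow I (gl1 I q) (gl2 I p q)"
      if "p \<in> {i, j, k}" "q \<in> {i, j, k}" for p q
      using gl1_arrow_gl2[of p q] that a(1,2) b(1) by auto
    let ?z = "M (gl2 I i k) (gl3 I j i k) z"
    have "M (gl1 I i) (gl2 I i k) ?z = M (gl1 I i) (gl2 I j i) a"
      using M_comp[OF arrow1(1)[of i k] arrow[of i k] z(1)] M_comp[OF arrow1(2)[of j i] arrow[of j i] z(1)]
      by (simp add: z)
    moreover have "M (gl1 I k) (gl2 I i k) ?z = M (gl1 I k) (gl2 I j k) b"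
      using M_comp[OF arrow1(2)[of i k] arrow[of i k] z(1)] M_comp[OF arrow1(2)[of j k] arrow[of j k] z(1)]
      by (simp add: z)
    moreover have "?z \<in> topspace (S (gl2 I i k))" using M_in[OF arrow z(1)] by auto
    ultimately show "((i, x), (k, w)) \<in> glue_rel" using a b unfolding glue_rel_def by blast
  qed
qed

text \<open>As \<open>G [i, i]\<close> is \<open>G [i]\<close>, the overlap of a piece with itself relates a point to itself only.\<close>

lemma glue_rel_same_index: "((i, x), (i, y)) \<in> glue_rel \<Longrightarrow> x = y"
  unfolding glue_rel_def by (auto simp: gl2_diag M_id gl_in_Ob)

lemma glued_up_leg:
  assumes "is_glued_up (Gl I) (op_cat (top_cat op)) G U l" "i \<in> I"
  shows "top_mor op (S (gl1 I i)) U (l (gl1 I i))"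
    and "j \<in> I \<Longrightarrow> z \<in> topspace (S (gl2 I i j)) \<Longrightarrow>
      l (gl1 I i) (M (gl1 I i) (gl2 I i j) z) = l (gl1 I j) (M (gl1 I j) (gl2 I i j) z)"
proof -
  have cone: "is_cone (Gl I) (op_cat (top_cat op)) G U l"
    using assms unfolding is_glued_up_def by blast
  then show "top_mor op (S (gl1 I i)) U (l (gl1 I i))"
    using gl_in_Ob(1)[OF assms(2)] unfolding is_cone_def by (auto simp: op_cat_simps top_cat_simps)
  assume "j \<in> I" "z \<in> topspace (S (gl2 I i j))"
  then show "l (gl1 I i) (M (gl1 I i) (gl2 I i j) z) = l (gl1 I j) (M (gl1 I j) (gl2 I i j) z)"
    using fun_cong[OF Gl_cone_leg[OF cone gl_in_Ob(2)[of i I j], of i], of z]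
      fun_cong[OF Gl_cone_leg[OF cone gl_in_Ob(2)[of i I j], of j], of z] assms(2)
    by (simp add: letters_gl op_cat_simps top_cat_simps compose_def)
qed

lemma glued_up_universal:
  assumes glued: "is_glued_up (Gl I) (op_cat (top_cat op)) G U l"
    and q: "\<And>i. i \<in> I \<Longrightarrow> top_mor op (S (gl1 I i)) (Y :: 'u topology) (q i)"
    and compat: "\<And>i j z. i \<in> I \<Longrightarrow> j \<in> I \<Longrightarrow> z \<in> topspace (S (gl2 I i j)) \<Longrightarrow>
      q i (M (gl1 I i) (gl2 I i j) z) = q j (M (gl1 I j) (gl2 I i j) z)"
  shows "\<exists>h. top_mor op U Y h \<and> (\<forall>i\<in>I. \<forall>x\<in>topspace (S (gl1 I i)). h (l (gl1 I i) x) = q i x)"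
    and "\<And>h h' u. \<lbrakk>top_mor op U Y h; top_mor op U Y h';
        \<And>i x. i \<in> I \<Longrightarrow> x \<in> topspace (S (gl1 I i)) \<Longrightarrow> h (l (gl1 I i) x) = q i x \<and> h' (l (gl1 I i) x) = q i x;
        u \<in> topspace U\<rbrakk> \<Longrightarrow> h u = h' u"
proof -
  let ?C = "op_cat (top_cat op) :: ('u topology, 'u \<Rightarrow> 'u) cat"
  let ?q = "\<lambda>i. restrict (q i) (topspace (S (gl1 I i)))"
  have C: "is_category ?C" by (intro is_category_op_cat is_category_top_cat)
  have lim: "is_limit (Gl I) ?C G U l"
    using is_glued_up_imp_is_limit[OF C G_functor glued] .
  have "\<exists>!h. h \<in> Hom ?C Y U \<and> (\<forall>i\<in>I. Comp ?C Y U (S (gl1 I i)) (l (gl1 I i)) h = ?q i)"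
  proof (rule lim[unfolded is_limit_Gl_iff[OF C G_functor], THEN conjunct2, rule_format])
    show "Y \<in> Ob ?C" by (simp add: op_cat_simps top_cat_simps)
    show "?q i \<in> Hom ?C Y (S (gl1 I i))" if "i \<in> I" for i
      using q[OF that] by (simp add: op_cat_simps top_cat_simps top_mor_restrict)
    show "Comp ?C Y (S (gl1 I i)) (S (gl2 I i j)) (M (gl1 I i) (gl2 I i j)) (?q i) =
        Comp ?C Y (S (gl1 I j)) (S (gl2 I i j)) (M (gl1 I j) (gl2 I i j)) (?q j)"
      if "i \<in> I" "j \<in> I" for i j
      using compat[OF that] M_in gl1_arrow_gl2[OF that]
      by (auto simp: op_cat_simps top_cat_simps compose_def fun_eq_iff)
  qed
  then have ex: "\<exists>!h. h \<in> extensional (topspace U) \<and> top_mor op U Y h \<and>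
      (\<forall>i\<in>I. compose (topspace (S (gl1 I i))) h (l (gl1 I i)) = ?q i)"
    by (simp add: op_cat_simps top_cat_simps)
  have comp_iff: "compose (topspace (S (gl1 I i))) h (l (gl1 I i)) = ?q i \<longleftrightarrow>
      (\<forall>x\<in>topspace (S (gl1 I i)). h (l (gl1 I i) x) = q i x)" for h i
    by (auto simp: compose_def fun_eq_iff restrict_def)
  show "\<exists>h. top_mor op U Y h \<and> (\<forall>i\<in>I. \<forall>x\<in>topspace (S (gl1 I i)). h (l (gl1 I i) x) = q i x)"
    using ex unfolding comp_iff by blast
  fix h h' u assume hs: "top_mor op U Y h" "top_mor op U Y h'" "u \<in> topspace U"
    "\<And>i x. i \<in> I \<Longrightarrow> x \<in> topspace (S (gl1 I i)) \<Longrightarrow> h (l (gl1 I i) x) = q i x \<and> h' (l (gl1 I i) x) = q i x"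
  have lU: "l (gl1 I i) x \<in> topspace U" if "i \<in> I" "x \<in> topspace (S (gl1 I i))" for i x
    using top_mor_funcset[OF glued_up_leg(1)[OF glued that(1)]] that(2) by blast
  have "restrict h (topspace U) = restrict h' (topspace U)"
    using hs lU by (intro Uniq_D[OF ex1_iff_ex_Uniq[THEN iffD1, OF ex, THEN conjunct2]])
      (auto simp: top_mor_restrict comp_iff)
  then show "h u = h' u" using hs(3) by (metis restrict_apply')
qed

text \<open>Collapsing the disjoint union of the pieces along the identifications gives a competitor of \<open>U\<close>
  into which each piece injects; with the final topology it is a competitor in \<open>oTop\<close> too, since
  the saturation of an open set is a union of images under the open maps out of the overlaps.
  Elements of \<open>'u\<close> serve as names for equivalence classes.\<close>

lemma glued_up_leg_inj:
  assumes inf: "infinite (UNIV :: 'u set)" and le: "I \<lesssim> (UNIV :: 'u set)"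
    and glued: "is_glued_up (Gl I) (op_cat (top_cat op)) G U l" and i: "i \<in> I"
  shows "inj_on (l (gl1 I i)) (topspace (S (gl1 I i)))"
proof -
  let ?\<Sigma> = "SIGMA i:I. topspace (S (gl1 I i))"
  obtain e :: "'i \<times> 'u \<Rightarrow> 'u" where e: "inj_on e (I \<times> UNIV)"
    using lepoll_times_universe[OF inf le] unfolding lepoll_def by blast
  note eqv = equiv_glue_rel[OF inf]
  define \<kappa> where "\<kappa> i x = e (SOME s. s \<in> glue_rel `` {(i, x)})" for i x
  have \<kappa>_eq: "\<kappa> i x = \<kappa> j y \<longleftrightarrow> ((i, x), (j, y)) \<in> glue_rel" if "(i, x) \<in> ?\<Sigma>" "(j, y) \<in> ?\<Sigma>" for i x j y
  proof
    have mem: "(SOME s. s \<in> glue_rel `` {t}) \<in> glue_rel `` {t}" if "t \<in> ?\<Sigma>" for t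
      using equiv_class_self[OF eqv that] by (rule someI)
    assume "\<kappa> i x = \<kappa> j y"
    moreover have "glue_rel `` {t} \<subseteq> I \<times> UNIV" for t
      unfolding glue_rel_def by auto
    ultimately have "(SOME s. s \<in> glue_rel `` {(i, x)}) = (SOME s. s \<in> glue_rel `` {(j, y)})"
      unfolding \<kappa>_def using inj_onD[OF e] mem that by blast
    then have "\<exists>s. ((i, x), s) \<in> glue_rel \<and> ((j, y), s) \<in> glue_rel"
      using mem[OF that(1)] mem[OF that(2)] by (metis Image_singleton_iff)
    then show "((i, x), (j, y)) \<in> glue_rel"
      using eqv unfolding equiv_def by (meson symD transD)
  next
    assume "((i, x), (j, y)) \<in> glue_rel"
    then show "\<kappa> i x = \<kappa> j y" unfolding \<kappa>_def using equiv_class_eq[OF eqv] by metis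
  qed
  obtain Q where Q: "topspace Q = (\<Union>i\<in>I. \<kappa> i ` topspace (S (gl1 I i)))"
      "final_topology I Q (\<lambda>i. S (gl1 I i)) \<kappa>"
    by (rule final_topology_exists)
  have mor: "top_mor op (S (gl1 I i)) Q (\<kappa> i)" if i: "i \<in> I" for i
    unfolding top_mor_def
  proof (intro conjI impI)
    show "continuous_map (S (gl1 I i)) Q (\<kappa> i)"
      using Q i unfolding final_topology_def continuous_map by auto
    assume op
    show "open_map (S (gl1 I i)) Q (\<kappa> i)"
      unfolding open_map_def
    proof (intro allI impI)
      fix W assume W: "openin (S (gl1 I i)) W"
      then have Wsub: "W \<subseteq> topspace (S (gl1 I i))" by (rule openin_subset)
      have "openin (S (gl1 I j)) {y \<in> topspace (S (gl1 I j)). \<kappa> j y \<in> \<kappa> i ` W}" if j: "j \<in> I" for j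
      proof -
        let ?N = "{z \<in> topspace (S (gl2 I i j)). M (gl1 I i) (gl2 I i j) z \<in> W}"
        note m = M_mor(1)[OF conjunct1[OF gl1_arrow_gl2[OF i j]]]
          M_mor(1)[OF conjunct2[OF gl1_arrow_gl2[OF i j]]]
        have "openin (S (gl2 I i j)) ?N"
          using m(1) W unfolding top_mor_def by (blast intro: openin_continuous_map_preimage)
        then have "openin (S (gl1 I j)) (M (gl1 I j) (gl2 I i j) ` ?N)"
          using m(2) \<open>op\<close> unfolding top_mor_def open_map_def by blast
        moreover have "{y \<in> topspace (S (gl1 I j)). \<kappa> j y \<in> \<kappa> i ` W} = M (gl1 I j) (gl2 I i j) ` ?N"
        proof -
          have "\<kappa> j y = \<kappa> i x \<longleftrightarrow> ((i, x), (j, y)) \<in> glue_rel"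
            if "y \<in> topspace (S (gl1 I j))" "x \<in> W" for x y
            using \<kappa>_eq[of i x j y] that Wsub i j by auto
          then have "{y \<in> topspace (S (gl1 I j)). \<kappa> j y \<in> \<kappa> i ` W} =
              {y \<in> topspace (S (gl1 I j)). \<exists>x\<in>W. ((i, x), (j, y)) \<in> glue_rel}"
            by blast
          also have "\<dots> = M (gl1 I j) (gl2 I i j) ` ?N"
            using top_mor_funcset[OF m(2)] i j unfolding glue_rel_def by blast
          finally show ?thesis .
        qed
        ultimately show ?thesis by simp
      qed
      moreover have "\<kappa> i ` W \<subseteq> topspace Q" using Q(1) Wsub i by blast
      ultimately show "openin Q (\<kappa> i ` W)" using Q(2) unfolding final_topology_def by blast
    qed
  qed
  have compat: "\<kappa> i (M (gl1 I i) (gl2 I i j) z) = \<kappa> j (M (gl1 I j) (gl2 I i j) z)"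
    if "i \<in> I" "j \<in> I" "z \<in> topspace (S (gl2 I i j))" for i j z
    using that M_in gl1_arrow_gl2[OF that(1,2)] by (subst \<kappa>_eq) (auto simp: glue_rel_def)
  obtain h where "\<And>x. x \<in> topspace (S (gl1 I i)) \<Longrightarrow> h (l (gl1 I i) x) = \<kappa> i x"
    using glued_up_universal(1)[OF glued mor compat] i by blast
  moreover have "inj_on (\<kappa> i) (topspace (S (gl1 I i)))"
    using \<kappa>_eq[of i _ i] glue_rel_same_index i by (auto simp: inj_on_def)
  ultimately show ?thesis by (metis (no_types, lifting) inj_on_def)
qed

text \<open>The union of the images of the pieces, as a subspace of \<open>U\<close>, receives a compatible family as
  well, so \<open>U\<close> retracts onto it.\<close>

lemma glued_up_leg_cover:
  assumes glued: "is_glued_up (Gl I) (op_cat (top_cat op)) G U l"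
  shows "(\<Union>i\<in>I. l (gl1 I i) ` topspace (S (gl1 I i))) = topspace U"
proof -
  let ?V = "\<Union>i\<in>I. l (gl1 I i) ` topspace (S (gl1 I i))"
  note leg = glued_up_leg(1)[OF glued] and compat = glued_up_leg(2)[OF glued]
  have VU: "?V \<subseteq> topspace U" using leg top_mor_funcset by blast
  have mor: "top_mor op (S (gl1 I i)) (subtopology U ?V) (l (gl1 I i))" if "i \<in> I" for i
    using leg[OF that] that unfolding top_mor_def
    by (auto intro!: continuous_map_into_subtopology open_map_into_subtopology)
  obtain h where h: "top_mor op U (subtopology U ?V) h"
      "\<And>i x. i \<in> I \<Longrightarrow> x \<in> topspace (S (gl1 I i)) \<Longrightarrow> h (l (gl1 I i) x) = l (gl1 I i) x"
    using glued_up_universal(1)[OF glued mor compat] by blast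
  have "openin U (l (gl1 I i) ` topspace (S (gl1 I i)))" if "op" "i \<in> I" for i
    using leg[OF that(2)] that(1) unfolding top_mor_def open_map_def by blast
  then have "openin U ?V" if op using that by blast
  then have "top_mor op (subtopology U ?V) U id"
    unfolding top_mor_def by (auto intro: continuous_map_from_subtopology open_map_from_open_subtopology open_map_id)
  then have hU: "top_mor op U U h" using top_mor_compose[OF h(1)] by fastforce
  have "top_mor op U U id" by (simp add: top_mor_def continuous_map_id open_map_id)
  then have "h u = u" if "u \<in> topspace U" for u
    using glued_up_universal(2)[OF glued leg compat hU _ _ that, of id] h(2) by simp
  moreover have "h u \<in> ?V" if "u \<in> topspace U" for u
    using funcset_mem[OF top_mor_funcset[OF h(1)] that] by simp
  ultimately have "u \<in> ?V" if "u \<in> topspace U" for u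
    using that by force
  then have "topspace U \<subseteq> ?V" by (rule subsetI)
  with VU show ?thesis by (rule subset_antisym)
qed

end

lemma associated_functor_imp_covering:
  assumes inf: "infinite (UNIV :: 'u set)" and le: "I \<lesssim> (UNIV :: 'u set)"
    and assoc: "associated_functor (top_cat op) I (U :: 'u topology) X \<iota> G"
  shows "(\<forall>i\<in>I. top_mor op (X i) U (\<iota> i) \<and> inj_on (\<iota> i) (topspace (X i))) \<and>
    (\<Union>i\<in>I. \<iota> i ` topspace (X i)) = topspace U"
proof -
  interpret space_gluing op I G
    using assoc unfolding associated_functor_def by unfold_locales blast
  obtain l where l: "\<And>i. i \<in> I \<Longrightarrow> l (gl1 I i) = restrict (\<iota> i) (topspace (X i))"
      and glued: "is_glued_up (Gl I) (op_cat (top_cat op)) G U l"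
    using assoc unfolding associated_functor_def glued_by_functor_def Gl_family_def by blast
  have S: "S (gl1 I i) = X i" if "i \<in> I" for i
    using assoc that unfolding associated_functor_def by blast
  have "top_mor op (X i) U (\<iota> i) \<and> inj_on (\<iota> i) (topspace (X i))" if i: "i \<in> I" for i
    using glued_up_leg(1)[OF glued i] glued_up_leg_inj[OF inf le glued i]
    by (simp add: l S i top_mor_restrict inj_on_restrict_eq)
  moreover have "(\<Union>i\<in>I. \<iota> i ` topspace (X i)) = topspace U"
    using glued_up_leg_cover[OF glued] by (simp add: l S cong: SUP_cong)
  ultimately show ?thesis by blast
qed

section \<open>Overlaps in a covering\<close>

locale space_covering =
  fixes op :: bool and I :: "'i set" and U :: "'u topology" and X :: "'i \<Rightarrow> 'u topology"
    and \<iota> :: "'i \<Rightarrow> 'u \<Rightarrow> 'u"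
  assumes mor: "i \<in> I \<Longrightarrow> top_mor op (X i) U (\<iota> i)"
    and inj: "i \<in> I \<Longrightarrow> inj_on (\<iota> i) (topspace (X i))"
    and cover: "(\<Union>i\<in>I. \<iota> i ` topspace (X i)) = topspace U"
begin

definition chart :: "'i \<Rightarrow> 'u \<Rightarrow> 'u" where
  "chart i = inv_into (topspace (X i)) (\<iota> i)"

text \<open>The common part of the pieces with indices in \<open>S\<close>, realised as a set of points of \<open>X i\<close>. The maps
  \<open>\<iota> i\<close> need not be embeddings, so the subspace topologies inherited from different pieces can
  disagree, and the transition maps between them need not be continuous. The coarsest topology that
  makes the transition maps to all the pieces \<open>X j\<close> continuous is, up to homeomorphism, independent
  of \<open>i \<in> S\<close>: it is that of the fibre product of the \<open>X j\<close> over \<open>U\<close>.\<close>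

definition overlap :: "'i \<Rightarrow> 'i set \<Rightarrow> 'u topology" where
  "overlap i S = pullback_topology {x \<in> topspace (X i). \<forall>j\<in>S. \<iota> i x \<in> \<iota> j ` topspace (X j)}
     (\<lambda>x. \<lambda>j\<in>S. chart j (\<iota> i x)) (product_topology X S)"

lemma \<iota>_in: "i \<in> I \<Longrightarrow> x \<in> topspace (X i) \<Longrightarrow> \<iota> i x \<in> topspace U"
  using cover by blast

lemma chart_in: "u \<in> \<iota> j ` topspace (X j) \<Longrightarrow> chart j u \<in> topspace (X j)"
  unfolding chart_def by (rule inv_into_into)

lemma \<iota>_chart: "u \<in> \<iota> j ` topspace (X j) \<Longrightarrow> \<iota> j (chart j u) = u"
  unfolding chart_def by (rule f_inv_into_f)

lemma chart_\<iota>: "j \<in> I \<Longrightarrow> x \<in> topspace (X j) \<Longrightarrow> chart j (\<iota> j x) = x"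
  unfolding chart_def by (rule inv_into_f_f[OF inj])

lemma topspace_overlap:
  "topspace (overlap i S) = {x \<in> topspace (X i). \<forall>j\<in>S. \<iota> i x \<in> \<iota> j ` topspace (X j)}"
  unfolding overlap_def topspace_pullback_topology by (auto simp: chart_in)

lemma continuous_map_chart_overlap:
  assumes "j \<in> S"
  shows "continuous_map (overlap i S) (X j) (\<lambda>x. chart j (\<iota> i x))"
proof -
  have "continuous_map (overlap i S) (X j) ((\<lambda>f. f j) \<circ> (\<lambda>x. \<lambda>j\<in>S. chart j (\<iota> i x)))"
    unfolding overlap_def
    by (intro continuous_map_pullback continuous_map_product_projection) (fact assms)
  then show ?thesis using assms by (simp add: o_def)
qed

lemma continuous_map_into_overlap:
  assumes "\<And>t. t \<in> topspace T \<Longrightarrow> h t \<in> topspace (overlap i S)"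
    and "\<And>j. j \<in> S \<Longrightarrow> continuous_map T (X j) (\<lambda>t. chart j (\<iota> i (h t)))"
  shows "continuous_map T (overlap i S) h"
  unfolding overlap_def
proof (rule continuous_map_pullback')
  show "continuous_map T (product_topology X S) ((\<lambda>x. \<lambda>j\<in>S. chart j (\<iota> i x)) \<circ> h)"
    unfolding continuous_map_componentwise using assms(2) by (auto simp: o_def cong: restrict_cong)
  show "topspace T \<subseteq> h -` {x \<in> topspace (X i). \<forall>j\<in>S. \<iota> i x \<in> \<iota> j ` topspace (X j)}"
    using assms(1) by (auto simp: topspace_overlap)
qed

lemma overlap_singleton:
  assumes "i \<in> I"
  shows "overlap i {i} = X i"
proof -
  have top: "topspace (overlap i {i}) = topspace (X i)" by (auto simp: topspace_overlap)
  have "continuous_map (X i) (X i) (\<lambda>x. chart i (\<iota> i x))"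
    by (rule continuous_map_eq[OF continuous_map_id]) (simp add: chart_\<iota>[OF assms])
  then have "continuous_map (X i) (overlap i {i}) id"
    by (intro continuous_map_into_overlap) (auto simp: top)
  moreover have "continuous_map (overlap i {i}) (X i) id"
    by (rule continuous_map_eq[OF continuous_map_chart_overlap[of i "{i}" i]])
      (simp_all add: top chart_\<iota>[OF assms])
  ultimately show ?thesis
    using topology_finer_continuous_id[OF top] topology_finer_continuous_id[OF top[symmetric]]
    by (auto simp: topology_eq)
qed

lemma inj_on_overlap: "i \<in> I \<Longrightarrow> inj_on (\<iota> i) (topspace (overlap i S))"
  using inj by (auto simp: topspace_overlap intro: inj_on_subset)

text \<open>When the \<open>\<iota> j\<close> are open, each \<open>chart j\<close> is continuous on the image of \<open>X j\<close>, so \<open>chart i\<close> is a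
  continuous inverse of \<open>\<iota> i\<close> on an intersection of finitely many open sets.\<close>

lemma overlap_\<iota>_mor:
  assumes S: "finite S" "S \<subseteq> I" "i \<in> S"
  shows "top_mor op (overlap i S) U (\<iota> i)"
  unfolding top_mor_def
proof (intro conjI impI)
  have iI: "i \<in> I" using S by blast
  have "continuous_map (overlap i S) U (\<lambda>x. \<iota> i (chart i (\<iota> i x)))"
    using continuous_map_compose[OF continuous_map_chart_overlap[OF S(3)]] mor[OF iI]
    by (fastforce simp: o_def top_mor_def)
  then show "continuous_map (overlap i S) U (\<iota> i)"
    by (rule continuous_map_eq) (auto simp: topspace_overlap chart_\<iota>[OF iI])
  assume op
  then have open_image: "openin U (\<iota> j ` V)" if "j \<in> I" "openin (X j) V" for j V
    using mor[OF that(1)] that(2) unfolding top_mor_def open_map_def by blast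
  let ?T = "\<Inter>j\<in>S. \<iota> j ` topspace (X j)"
  have T: "openin U ?T" using S open_image by (intro openin_INT2) auto
  have "continuous_map (subtopology U ?T) (X j) (chart j)" if j: "j \<in> S" for j
    unfolding continuous_map
  proof (intro conjI allI impI)
    show "chart j ` topspace (subtopology U ?T) \<subseteq> topspace (X j)" using j chart_in by auto
    fix V assume V: "openin (X j) V"
    have "{u \<in> topspace (subtopology U ?T). chart j u \<in> V} = ?T \<inter> \<iota> j ` V"
    proof (intro equalityI subsetI)
      fix u assume "u \<in> {u \<in> topspace (subtopology U ?T). chart j u \<in> V}"
      then show "u \<in> ?T \<inter> \<iota> j ` V"
        using j \<iota>_chart[of u j] by (auto intro!: image_eqI[of _ _ "chart j u"])
    next
      fix u assume u: "u \<in> ?T \<inter> \<iota> j ` V"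
      then have "u \<in> topspace U" using openin_subset[OF T] by blast
      moreover have "chart j u \<in> V"
        using u subsetD[OF S(2) j] subsetD[OF openin_subset[OF V]] chart_\<iota>[of j] by auto
      ultimately show "u \<in> {u \<in> topspace (subtopology U ?T). chart j u \<in> V}" using u by auto
    qed
    moreover have "openin U (\<iota> j ` V)" using open_image V j S by blast
    ultimately show "openin (subtopology U ?T) {u \<in> topspace (subtopology U ?T). chart j u \<in> V}"
      by (auto simp: openin_subtopology_Int2)
  qed
  then have "continuous_map (subtopology U ?T) (X j) (\<lambda>u. chart j (\<iota> i (chart i u)))" if "j \<in> S" for j
    by (rule continuous_map_eq) (use that S(3) in \<open>auto simp: \<iota>_chart\<close>)
  moreover have "chart i u \<in> topspace (overlap i S)" if "u \<in> topspace (subtopology U ?T)" for u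
  proof -
    have u: "u \<in> \<iota> j ` topspace (X j)" if "j \<in> S" for j
      using \<open>u \<in> topspace (subtopology U ?T)\<close> that by simp
    show ?thesis
      unfolding topspace_overlap using chart_in[OF u[OF S(3)]] \<iota>_chart[OF u[OF S(3)]] u by simp
  qed
  ultimately have chart: "continuous_map (subtopology U ?T) (overlap i S) (chart i)"
    by (intro continuous_map_into_overlap)
  show "open_map (overlap i S) U (\<iota> i)"
    unfolding open_map_def
  proof (intro allI impI)
    fix W assume W: "openin (overlap i S) W"
    have sub: "W \<subseteq> topspace (overlap i S)" using W by (rule openin_subset)
    have "{u \<in> topspace (subtopology U ?T). chart i u \<in> W} = \<iota> i ` W"
    proof (intro equalityI subsetI)
      fix u assume "u \<in> {u \<in> topspace (subtopology U ?T). chart i u \<in> W}"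
      then show "u \<in> \<iota> i ` W" using S(3) \<iota>_chart[of u i] by (intro image_eqI[of _ _ "chart i u"]) auto
    next
      fix u assume "u \<in> \<iota> i ` W"
      then show "u \<in> {u \<in> topspace (subtopology U ?T). chart i u \<in> W}"
        using sub iI by (auto simp: topspace_overlap chart_\<iota> \<iota>_in subset_iff)
    qed
    moreover have "openin (subtopology U ?T) {u \<in> topspace (subtopology U ?T). chart i u \<in> W}"
      using chart W by (rule openin_continuous_map_preimage)
    ultimately show "openin U (\<iota> i ` W)" using T openin_trans_full by metis
  qed
qed

lemma into_overlap_mor:
  assumes S: "finite S" "S \<subseteq> I" "i \<in> S" and f: "top_mor op T U f"
    and h: "\<And>t. t \<in> topspace T \<Longrightarrow> h t \<in> topspace (overlap i S) \<and> \<iota> i (h t) = f t"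
    and c: "\<And>j. j \<in> S \<Longrightarrow> continuous_map T (X j) (\<lambda>t. chart j (f t))"
  shows "top_mor op T (overlap i S) h"
proof (rule top_mor_left_factor)
  show "top_mor op T U (\<lambda>t. \<iota> i (h t))" using f h by (auto intro: top_mor_eq)
  have "continuous_map T (X j) (\<lambda>t. chart j (\<iota> i (h t)))" if "j \<in> S" for j
    using c[OF that] by (rule continuous_map_eq) (simp add: h)
  then show "continuous_map T (overlap i S) h"
    by (intro continuous_map_into_overlap) (auto simp: h)
  show "continuous_map (overlap i S) U (\<iota> i)" "inj_on (\<iota> i) (topspace (overlap i S))"
    using overlap_\<iota>_mor[OF S] inj_on_overlap S by (auto simp: top_mor_def)
qed

lemma transition_in:
  "i \<in> S \<Longrightarrow> k \<in> R \<Longrightarrow> R \<subseteq> S \<Longrightarrow> x \<in> topspace (overlap i S) \<Longrightarrow>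
    chart k (\<iota> i x) \<in> topspace (overlap k R) \<and> \<iota> k (chart k (\<iota> i x)) = \<iota> i x"
  by (auto simp: topspace_overlap \<iota>_chart chart_in subset_iff)

lemma transition_mor:
  assumes "finite S" "S \<subseteq> I" "i \<in> S" "k \<in> R" "R \<subseteq> S"
  shows "top_mor op (overlap i S) (overlap k R) (\<lambda>x. chart k (\<iota> i x))"
  by (rule into_overlap_mor[where f = "\<iota> i"])
    (use assms transition_in[OF assms(3-5)] overlap_\<iota>_mor[OF assms(1-3)] continuous_map_chart_overlap
      in \<open>auto intro: finite_subset\<close>)

section \<open>From a covering to a functor\<close>

text \<open>Any index in the class \<open>a\<close> can serve to realise the object \<open>a\<close>; over \<open>U\<close> the choice is immaterial.\<close>

definition head :: "'i gl_word set \<Rightarrow> 'i" where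
  "head a = (SOME i. i \<in> letters a)"

definition cov_functor :: "('i gl_word set, unit, 'u topology, 'u \<Rightarrow> 'u) fctr" where
  "cov_functor = \<lparr>fob = (\<lambda>a. overlap (head a) (letters a)),
     fmor = (\<lambda>a b m. restrict (\<lambda>x. chart (head a) (\<iota> (head b) x)) (topspace (overlap (head b) (letters b))))\<rparr>"

lemma head_in: "a \<in> Ob (Gl I) \<Longrightarrow> head a \<in> letters a"
  unfolding head_def using letters_nonempty some_in_eq by metis

lemma head_in_I: "a \<in> Ob (Gl I) \<Longrightarrow> head a \<in> I"
  using head_in letters_subset by blast

lemma cov_functor_gl1: "i \<in> I \<Longrightarrow> head (gl1 I i) = i \<and> fob cov_functor (gl1 I i) = X i"
  by (simp add: cov_functor_def head_def letters_gl overlap_singleton)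

lemma cov_functor_fmor:
  "x \<in> topspace (fob cov_functor b) \<Longrightarrow> fmor cov_functor a b m x = chart (head a) (\<iota> (head b) x)"
  by (simp add: cov_functor_def)

lemma \<iota>_cov_functor_fmor:
  assumes "gl_arrow I a b" "x \<in> topspace (fob cov_functor b)"
  shows "\<iota> (head a) (fmor cov_functor a b m x) = \<iota> (head b) x"
    and "fmor cov_functor a b m x \<in> topspace (fob cov_functor a)"
  using transition_in[OF head_in head_in gl_arrow_letters[OF assms(1)]] gl_arrow_Ob[OF assms(1)] assms(2)
  by (auto simp: cov_functor_def)

lemma cov_functor_mor:
  assumes "gl_arrow I a b"
  shows "top_mor op (fob cov_functor b) (fob cov_functor a) (fmor cov_functor a b m)"
proof -
  have a: "a \<in> Ob (Gl I)" and b: "b \<in> Ob (Gl I)" using gl_arrow_Ob[OF assms] by auto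
  show ?thesis
    using transition_mor[OF finite_letters[OF b] letters_subset[OF b] head_in[OF b] head_in[OF a]
        gl_arrow_letters[OF assms]]
    by (simp add: cov_functor_def top_mor_restrict)
qed

lemma cov_functor_\<iota>_mor: "a \<in> Ob (Gl I) \<Longrightarrow> top_mor op (fob cov_functor a) U (\<iota> (head a))"
  using overlap_\<iota>_mor[OF finite_letters letters_subset head_in] by (simp add: cov_functor_def)

lemma cov_functor_inj:
  "a \<in> Ob (Gl I) \<Longrightarrow> x \<in> topspace (fob cov_functor a) \<Longrightarrow> y \<in> topspace (fob cov_functor a) \<Longrightarrow>
    \<iota> (head a) x = \<iota> (head a) y \<Longrightarrow> x = y"
  using inj_on_overlap[OF head_in_I] by (auto simp: cov_functor_def inj_on_def)

text \<open>All equations between maps are checked after composition with the injections into \<open>U\<close>.\<close>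

lemma is_functor_cov_functor: "is_functor (Gl I) (op_cat (top_cat op)) cov_functor"
  unfolding is_functor_def
proof (intro conjI ballI)
  fix a b m assume "m \<in> Hom (Gl I) a b"
  then show "fmor cov_functor a b m \<in> Hom (op_cat (top_cat op)) (fob cov_functor a) (fob cov_functor b)"
    using cov_functor_mor by (auto simp: Hom_Gl op_cat_simps top_cat_simps) (simp add: cov_functor_def)
next
  fix a assume a: "a \<in> Ob (Gl I)"
  have "fmor cov_functor a a m x = x" if "x \<in> topspace (fob cov_functor a)" for x m
    using that chart_\<iota>[OF head_in_I[OF a]] unfolding cov_functor_fmor[OF that]
    by (simp add: cov_functor_def topspace_overlap)
  then show "fmor cov_functor a a (Id (Gl I) a) = Id (op_cat (top_cat op)) (fob cov_functor a)"
    by (auto simp: op_cat_simps top_cat_simps fun_eq_iff) (simp add: cov_functor_def)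
next
  fix a b c m n assume ab: "m \<in> Hom (Gl I) a b" and bc: "n \<in> Hom (Gl I) b c"
  then have arrows: "gl_arrow I a b" "gl_arrow I b c" by (simp_all add: Hom_Gl)
  have "fmor cov_functor a c k x = fmor cov_functor a b m (fmor cov_functor b c n x)"
    if x: "x \<in> topspace (fob cov_functor c)" for x k
    using \<iota>_cov_functor_fmor[OF arrows(2) x] x by (simp add: cov_functor_fmor)
  then show "fmor cov_functor a c (Comp (Gl I) a b c n m) =
      Comp (op_cat (top_cat op)) (fob cov_functor a) (fob cov_functor b) (fob cov_functor c)
        (fmor cov_functor b c n) (fmor cov_functor a b m)"
    by (auto simp: op_cat_simps top_cat_simps compose_def fun_eq_iff) (simp add: cov_functor_def)
qed (simp add: op_cat_simps top_cat_simps)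

lemma gluing_data_functor_cov_functor: "gluing_data_functor (op_cat (top_cat op)) I cov_functor"
  unfolding gluing_data_functor_def
proof (intro conjI ballI)
  fix i j k assume I: "i \<in> I" "j \<in> I" "k \<in> I"
  let ?C = "op_cat (top_cat op) :: ('u topology, 'u \<Rightarrow> 'u) cat"
  let ?a = "gl1 I i" and ?b = "gl2 I i j" and ?c = "gl2 I i k" and ?d = "gl3 I i j k"
  let ?F = "fob cov_functor" and ?M = "\<lambda>a b. fmor cov_functor a b ()"
  have arrows: "gl_arrow I ?a ?b" "gl_arrow I ?a ?c" "gl_arrow I ?b ?d" "gl_arrow I ?c ?d"
    using I by (auto intro: gl_arrow.eta2 gl_arrow.eta3)
  have Obs: "?a \<in> Ob (Gl I)" "?b \<in> Ob (Gl I)" "?c \<in> Ob (Gl I)" "?d \<in> Ob (Gl I)"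
    using I by (auto simp: gl_in_Ob)
  have M_Hom: "?M p q \<in> Hom ?C (?F p) (?F q)" if "gl_arrow I p q" for p q
    using is_functor_cov_functor that gl_arrow_Ob[OF that] Hom_Gl[of "()" I p q]
    unfolding is_functor_def by blast
  show "is_pushout ?C (?F ?a) (?F ?b) (?F ?c) (?M ?a ?b) (?M ?a ?c) (?F ?d) (?M ?b ?d) (?M ?c ?d)"
    unfolding is_pushout_def
  proof (intro conjI ballI impI)
    show "Comp ?C (?F ?a) (?F ?b) (?F ?d) (?M ?b ?d) (?M ?a ?b) =
        Comp ?C (?F ?a) (?F ?c) (?F ?d) (?M ?c ?d) (?M ?a ?c)"
    proof -
      have "?M ?a ?b (?M ?b ?d x) = ?M ?a ?c (?M ?c ?d x)" if "x \<in> topspace (?F ?d)" for x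
        using \<iota>_cov_functor_fmor[OF arrows(3) that] \<iota>_cov_functor_fmor[OF arrows(4) that]
        by (simp add: cov_functor_fmor)
      then show ?thesis by (auto simp: op_cat_simps top_cat_simps compose_def)
    qed
  next
    fix Y r s assume r_Hom: "r \<in> Hom ?C (?F ?b) Y" and s_Hom: "s \<in> Hom ?C (?F ?c) Y"
      and eq: "Comp ?C (?F ?a) (?F ?b) Y r (?M ?a ?b) = Comp ?C (?F ?a) (?F ?c) Y s (?M ?a ?c)"
    have r: "top_mor op Y (?F ?b) r" "r \<in> extensional (topspace Y)"
      and s: "top_mor op Y (?F ?c) s" "s \<in> extensional (topspace Y)"
      using r_Hom s_Hom by (auto simp: op_cat_simps top_cat_simps)
    have rs_in: "r y \<in> topspace (?F ?b)" "s y \<in> topspace (?F ?c)" if "y \<in> topspace Y" for y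
      using that top_mor_funcset[OF r(1)] top_mor_funcset[OF s(1)] by auto
    define f where "f y = \<iota> (head ?b) (r y)" for y
    have f_s: "f y = \<iota> (head ?c) (s y)" if y: "y \<in> topspace Y" for y
    proof -
      have "?M ?a ?b (r y) = ?M ?a ?c (s y)"
        using fun_cong[OF eq, of y] y by (simp add: op_cat_simps top_cat_simps compose_def)
      then show ?thesis
        using \<iota>_cov_functor_fmor(1)[OF arrows(1) rs_in(1)[OF y]]
          \<iota>_cov_functor_fmor(1)[OF arrows(2) rs_in(2)[OF y]] unfolding f_def by metis
    qed
    have f_mor: "top_mor op Y U f"
      using top_mor_compose[OF r(1) cov_functor_\<iota>_mor[OF Obs(2)]] by (simp add: f_def[abs_def] o_def)
    \<comment> \<open>Each of the three indices is seen by \<open>r\<close> or by \<open>s\<close>.\<close>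
    have f_chart: "continuous_map Y (X n) (\<lambda>y. chart n (f y))"
      and f_in: "\<And>y. y \<in> topspace Y \<Longrightarrow> f y \<in> \<iota> n ` topspace (X n)" if n: "n \<in> {i, j, k}" for n
    proof -
      consider "n \<in> letters ?b" | "n \<in> letters ?c" using n I by (auto simp: letters_gl)
      then have "continuous_map Y (X n) (\<lambda>y. chart n (f y)) \<and>
        (\<forall>y\<in>topspace Y. f y \<in> \<iota> n ` topspace (X n))"
      proof cases
        case 1
        have "continuous_map Y (X n) (\<lambda>y. chart n (f y))"
          using continuous_map_compose[OF _ continuous_map_chart_overlap[OF 1, of "head ?b"]] r(1)
          by (force simp: o_def f_def top_mor_def cov_functor_def)
        moreover have "\<forall>y\<in>topspace Y. f y \<in> \<iota> n ` topspace (X n)"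
          using rs_in(1) 1 by (auto simp: f_def cov_functor_def topspace_overlap)
        ultimately show ?thesis by blast
      next
        case 2
        have "continuous_map Y (X n) (\<lambda>y. chart n (\<iota> (head ?c) (s y)))"
          using continuous_map_compose[OF _ continuous_map_chart_overlap[OF 2, of "head ?c"]] s(1)
          by (force simp: o_def top_mor_def cov_functor_def)
        then have "continuous_map Y (X n) (\<lambda>y. chart n (f y))"
          by (rule continuous_map_eq) (simp add: f_s)
        moreover have "\<forall>y\<in>topspace Y. f y \<in> \<iota> n ` topspace (X n)"
          using rs_in(2) 2 f_s by (auto simp: cov_functor_def topspace_overlap)
        ultimately show ?thesis by blast
      qed
      then show "continuous_map Y (X n) (\<lambda>y. chart n (f y))"
        "\<And>y. y \<in> topspace Y \<Longrightarrow> f y \<in> \<iota> n ` topspace (X n)" by auto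
    qed
    let ?h = "restrict (\<lambda>y. chart (head ?d) (f y)) (topspace Y)"
    have hd: "head ?d \<in> {i, j, k}" using head_in[OF Obs(4)] I by (simp add: letters_gl)
    have h_in: "?h y \<in> topspace (?F ?d)" "\<iota> (head ?d) (?h y) = f y" if "y \<in> topspace Y" for y
      using that f_in I hd by (auto simp: cov_functor_def topspace_overlap letters_gl \<iota>_chart chart_in)
    have h_mor: "top_mor op Y (?F ?d) ?h"
      unfolding cov_functor_def fctr.simps
      using I finite_letters[OF Obs(4)] letters_subset[OF Obs(4)] head_in[OF Obs(4)]
      by (intro into_overlap_mor[where f = f])
        (use f_mor h_in f_chart in \<open>auto simp: cov_functor_def letters_gl\<close>)
    show "\<exists>!h. h \<in> Hom ?C (?F ?d) Y \<and> Comp ?C (?F ?b) (?F ?d) Y h (?M ?b ?d) = r \<and>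
        Comp ?C (?F ?c) (?F ?d) Y h (?M ?c ?d) = s"
    proof (rule ex1I[of _ ?h], intro conjI)
      show "?h \<in> Hom ?C (?F ?d) Y" using h_mor by (simp add: op_cat_simps top_cat_simps)
      have "?M ?b ?d (?h y) = r y" if y: "y \<in> topspace Y" for y
        by (rule cov_functor_inj[OF Obs(2)])
          (use \<iota>_cov_functor_fmor[OF arrows(3) h_in(1)[OF y]] h_in(2)[OF y] rs_in(1)[OF y] f_def
            in auto)
      then show "Comp ?C (?F ?b) (?F ?d) Y ?h (?M ?b ?d) = r"
        using r(2) by (auto simp: op_cat_simps top_cat_simps compose_def extensional_def)
      have "?M ?c ?d (?h y) = s y" if y: "y \<in> topspace Y" for y
        by (rule cov_functor_inj[OF Obs(3)])
          (use \<iota>_cov_functor_fmor[OF arrows(4) h_in(1)[OF y]] h_in(2)[OF y] rs_in(2)[OF y] f_s[OF y]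
            in auto)
      then show "Comp ?C (?F ?c) (?F ?d) Y ?h (?M ?c ?d) = s"
        using s(2) by (auto simp: op_cat_simps top_cat_simps compose_def extensional_def)
    next
      fix h assume h: "h \<in> Hom ?C (?F ?d) Y \<and> Comp ?C (?F ?b) (?F ?d) Y h (?M ?b ?d) = r \<and>
        Comp ?C (?F ?c) (?F ?d) Y h (?M ?c ?d) = s"
      then have ext: "h \<in> extensional (topspace Y)" and hm: "top_mor op Y (?F ?d) h"
        and hr: "compose (topspace Y) (?M ?b ?d) h = r"
        by (simp_all add: op_cat_simps top_cat_simps)
      have "h y = ?h y" if y: "y \<in> topspace Y" for y
      proof (rule cov_functor_inj[OF Obs(4)])
        show hy: "h y \<in> topspace (?F ?d)" using top_mor_funcset[OF hm] y by blast
        show "?h y \<in> topspace (?F ?d)" using h_in(1)[OF y] .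
        have "?M ?b ?d (h y) = r y" using fun_cong[OF hr, of y] y by (simp add: compose_def)
        then show "\<iota> (head ?d) (h y) = \<iota> (head ?d) (?h y)"
          using \<iota>_cov_functor_fmor(1)[OF arrows(3) hy, of "()"] h_in(2)[OF y] by (simp add: f_def)
      qed
      then show "h = ?h" using ext by (auto simp: extensional_def fun_eq_iff)
    qed
  qed (use M_Hom arrows in \<open>simp_all add: op_cat_simps(1) top_cat_simps(1)\<close>)
qed (fact is_functor_cov_functor)

text \<open>A compatible family of maps out of the pieces glues to a function on \<open>U\<close>, which is continuous
  because \<open>U\<close> carries the final topology, and open if all the members of the family are.\<close>

lemma covering_glued_by_cov_functor:
  assumes final: "final_topology I U X \<iota>"
  shows "glued_by_functor (top_cat op) I U X \<iota> cov_functor"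
proof -
  let ?C = "op_cat (top_cat op) :: ('u topology, 'u \<Rightarrow> 'u) cat"
  let ?F = "fob cov_functor" and ?M = "\<lambda>a b. fmor cov_functor a b ()"
  define l where "l a = restrict (\<iota> (head a)) (topspace (?F a))" for a
  have C: "is_category ?C" by (intro is_category_op_cat is_category_top_cat)
  have push: "l b = compose (topspace (?F b)) (l a) (fmor cov_functor a b m)" if "gl_arrow I a b" for a b m
    using \<iota>_cov_functor_fmor[OF that] by (auto simp: l_def compose_def fun_eq_iff)
  have F1: "?F (gl1 I i) = X i" if "i \<in> I" for i using cov_functor_gl1[OF that] by blast
  have l1: "l (gl1 I i) = restrict (\<iota> i) (topspace (X i))" if "i \<in> I" for i
    using cov_functor_gl1[OF that] by (simp add: l_def)
  have arrow1: "gl_arrow I (gl1 I i) (gl2 I i j)" "gl_arrow I (gl1 I j) (gl2 I i j)" if "i \<in> I" "j \<in> I" for i j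
    using that by (auto intro!: gl_arrow_from_gl1 simp: gl_in_Ob letters_gl)
  have family: "Gl_family (top_cat op) I U X \<iota> cov_functor l"
    unfolding Gl_family_def top_cat_simps using l1
    by (intro conjI ballI push gl_arrow.eta2 gl_arrow.eta3) auto
  have "is_limit (Gl I) ?C cov_functor U l"
    unfolding is_limit_Gl_iff[OF C is_functor_cov_functor]
  proof (intro conjI ballI allI impI)
    show "is_cone (Gl I) ?C cov_functor U l"
      unfolding is_cone_def
      by (auto simp: op_cat_simps top_cat_simps Hom_Gl push[symmetric])
        (auto simp: l_def top_mor_restrict cov_functor_\<iota>_mor)
  next
    fix Y :: "'u topology" and q
    assume q_Hom: "\<forall>i\<in>I. q i \<in> Hom ?C Y (?F (gl1 I i))"
      and compat: "\<forall>i\<in>I. \<forall>j\<in>I.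
        Comp ?C Y (?F (gl1 I i)) (?F (gl2 I i j)) (?M (gl1 I i) (gl2 I i j)) (q i) =
        Comp ?C Y (?F (gl1 I j)) (?F (gl2 I i j)) (?M (gl1 I j) (gl2 I i j)) (q j)"
    have q: "top_mor op (X i) Y (q i)" "q i \<in> extensional (topspace (X i))" if "i \<in> I" for i
      using bspec[OF q_Hom that] by (simp_all add: op_cat_simps top_cat_simps F1 that)
    have q_eq: "q i x = q j y"
      if i: "i \<in> I" "x \<in> topspace (X i)" and j: "j \<in> I" "y \<in> topspace (X j)" and xy: "\<iota> i x = \<iota> j y" for i j x y
    proof -
      let ?b = "gl2 I i j"
      have b: "?b \<in> Ob (Gl I)" using i j by (simp add: gl_in_Ob)
      define z where "z = chart (head ?b) (\<iota> i x)"
      have lb: "letters ?b = {i, j}" using i j by (simp add: letters_gl)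
      have img: "\<iota> i x \<in> \<iota> n ` topspace (X n)" if "n \<in> {i, j}" for n
        using that i j imageI[of x "topspace (X i)" "\<iota> i"] imageI[of y "topspace (X j)" "\<iota> j"] xy by auto
      have hb: "head ?b \<in> {i, j}" using head_in[OF b] lb by simp
      have z: "z \<in> topspace (?F ?b)" "\<iota> (head ?b) z = \<iota> i x"
        using img \<iota>_chart[OF img[OF hb]] chart_in[OF img[OF hb]]
        by (auto simp: z_def cov_functor_def topspace_overlap lb)
      have "?M (gl1 I i) ?b z = x" "?M (gl1 I j) ?b z = y"
        using z xy chart_\<iota>[OF i] chart_\<iota>[OF j] i(1) j(1)
        by (simp_all add: cov_functor_fmor cov_functor_gl1)
      then show ?thesis
        using fun_cong[OF bspec[OF bspec[OF compat i(1)] j(1)], of z] z(1)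
        by (simp add: op_cat_simps top_cat_simps compose_def)
    qed
    define idx where "idx u = (SOME i. i \<in> I \<and> u \<in> \<iota> i ` topspace (X i))" for u
    define h where "h = restrict (\<lambda>u. q (idx u) (chart (idx u) u)) (topspace U)"
    have h_\<iota>: "h (\<iota> i x) = q i x" if i: "i \<in> I" "x \<in> topspace (X i)" for i x
    proof -
      have "idx (\<iota> i x) \<in> I \<and> \<iota> i x \<in> \<iota> (idx (\<iota> i x)) ` topspace (X (idx (\<iota> i x)))"
        unfolding idx_def by (rule someI[of _ i]) (use i in auto)
      then show ?thesis
        using q_eq[of "idx (\<iota> i x)" "chart (idx (\<iota> i x)) (\<iota> i x)" i x] i
        by (simp add: h_def \<iota>_in chart_in \<iota>_chart)
    qed
    have pts: "\<exists>i\<in>I. \<exists>x\<in>topspace (X i). u = \<iota> i x" if "u \<in> topspace U" for u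
      using that cover by blast
    have h_in: "h u \<in> topspace Y" if u: "u \<in> topspace U" for u
      using pts[OF u] h_\<iota> q(1)[THEN top_mor_funcset] by fastforce
    have h_cont: "continuous_map U Y h"
    proof -
      have "continuous_map (X i) Y (\<lambda>x. h (\<iota> i x))" if i: "i \<in> I" for i
        using q(1)[OF i] h_\<iota>[OF i] unfolding top_mor_def by (auto intro: continuous_map_eq)
      then show ?thesis
        using final_topology_continuous_iff[OF final, of h Y] \<iota>_in h_in by auto
    qed
    have h_open: "open_map U Y h" if op
      unfolding open_map_def
    proof (intro allI impI)
      fix W assume W: "openin U W"
      have "h ` W = (\<Union>i\<in>I. q i ` {x \<in> topspace (X i). \<iota> i x \<in> W})"
        using h_\<iota> pts openin_subset[OF W] by (auto simp: image_iff) (metis (no_types, lifting) subsetD)+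
      moreover have "openin Y (q i ` {x \<in> topspace (X i). \<iota> i x \<in> W})" if i: "i \<in> I" for i
        using q(1)[OF i] mor[OF i] W \<open>op\<close> unfolding top_mor_def open_map_def
        by (blast intro: openin_continuous_map_preimage)
      ultimately show "openin Y (h ` W)" by auto
    qed
    show "\<exists>!h. h \<in> Hom ?C Y U \<and> (\<forall>i\<in>I. Comp ?C Y U (?F (gl1 I i)) (l (gl1 I i)) h = q i)"
    proof (rule ex1I[of _ h], intro conjI ballI)
      show "h \<in> Hom ?C Y U"
        using h_cont h_open by (auto simp: op_cat_simps top_cat_simps top_mor_def h_def)
      show "Comp ?C Y U (?F (gl1 I i)) (l (gl1 I i)) h = q i" if i: "i \<in> I" for i
        using h_\<iota>[OF i] q(2)[OF i] i
        by (auto simp: op_cat_simps top_cat_simps F1 l1 compose_def fun_eq_iff extensional_def)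
    next
      fix g assume g: "g \<in> Hom ?C Y U \<and> (\<forall>i\<in>I. Comp ?C Y U (?F (gl1 I i)) (l (gl1 I i)) g = q i)"
      have "g (\<iota> i x) = q i x" if i: "i \<in> I" "x \<in> topspace (X i)" for i x
        using fun_cong[OF bspec[OF conjunct2[OF g] i(1)], of x] i
        by (simp add: op_cat_simps top_cat_simps F1 l1 compose_def)
      then have "g u = h u" if "u \<in> topspace U" for u using pts[OF that] h_\<iota> by auto
      then show "g = h"
        using g by (auto simp: op_cat_simps top_cat_simps extensional_def h_def fun_eq_iff)
    qed
  qed
  then show ?thesis
    unfolding glued_by_functor_def
    using family is_limit_imp_is_glued_up[OF C is_functor_cov_functor] by blast
qed

lemma associated_cov_functor:
  "final_topology I U X \<iota> \<Longrightarrow> associated_functor (top_cat op) I U X \<iota> cov_functor"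
  unfolding associated_functor_def
  by (simp add: gluing_data_functor_cov_functor cov_functor_gl1 covering_glued_by_cov_functor)

section \<open>From a covering to gluing data\<close>

text \<open>Since the maps \<open>ups\<close> are inclusions, a point of a triple fibre product is a diagonal pair.\<close>

definition cov_data :: "('i, 'u) gluing_data" where
  "cov_data = \<lparr>spc = X, ovl = (\<lambda>i j. overlap i {i, j}), ups = (\<lambda>i j x. x),
     phi = (\<lambda>i j x. chart j (\<iota> i x)),
     phi3 = (\<lambda>k i j z. (chart j (\<iota> i (fst z)), chart j (\<iota> i (fst z))))\<rparr>"

lemma cov_data_simps:
  "spc cov_data = X" "ovl cov_data i j = overlap i {i, j}" "ups cov_data i j = (\<lambda>x. x)"
  "phi cov_data i j = (\<lambda>x. chart j (\<iota> i x))"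
  "phi3 cov_data k i j = (\<lambda>z. (chart j (\<iota> i (fst z)), chart j (\<iota> i (fst z))))"
  by (simp_all add: cov_data_def)

lemma topspace_triple:
  "topspace (triple cov_data i j k) = {(x, x) |x. x \<in> topspace (overlap i {i, j, k})}"
  by (auto simp: triple_def cov_data_simps pullback_space_def topspace_overlap)

lemma in_tripleE:
  assumes "z \<in> topspace (triple cov_data i j k)"
  obtains x where "z = (x, x)" "x \<in> topspace (X i)" "\<iota> i x \<in> \<iota> j ` topspace (X j)"
    "\<iota> i x \<in> \<iota> k ` topspace (X k)"
proof -
  obtain x where "z = (x, x)" "x \<in> topspace (overlap i {i, j, k})"
    using assms unfolding topspace_triple by blast
  then show ?thesis using that[of x] by (simp add: topspace_overlap)
qed

lemma phi3_continuous:
  assumes I: "i \<in> I" "j \<in> I" "k \<in> I"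
  shows "continuous_map (triple cov_data i j k) (triple cov_data j i k) (phi3 cov_data k i j)"
proof -
  let ?T = "triple cov_data i j k"
  have fst: "continuous_map ?T (overlap i {i, j}) fst" and snd: "continuous_map ?T (overlap i {i, k}) snd"
    unfolding triple_def pullback_space_def cov_data_simps
    by (auto intro: continuous_map_from_subtopology continuous_map_fst continuous_map_snd)
  let ?g = "\<lambda>z. chart j (\<iota> i (fst z))"
  have g: "?g z \<in> topspace (overlap j {i, j, k})" "\<iota> j (?g z) = \<iota> i (fst z)" "snd z = fst z"
    if "z \<in> topspace ?T" for z
    using that transition_in[of i "{i, j, k}" j "{i, j, k}"] by (auto simp: topspace_triple)
  have n_cont: "continuous_map ?T (X n) (\<lambda>z. chart n (\<iota> i (fst z)))" if "n \<in> {i, j, k}" for n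
  proof (cases "n \<in> {i, j}")
    case True
    show ?thesis
      using continuous_map_compose[OF fst continuous_map_chart_overlap[OF True]] by (simp add: o_def)
  next
    case False
    then have "continuous_map ?T (X n) (\<lambda>z. chart n (\<iota> i (snd z)))"
      using continuous_map_compose[OF snd continuous_map_chart_overlap[of n]] that by (force simp: o_def)
    then show ?thesis by (rule continuous_map_eq) (simp add: g(3))
  qed
  have "continuous_map ?T (overlap j {j, n}) ?g" if n: "n \<in> {i, k}" for n
  proof (rule continuous_map_into_overlap)
    show "?g z \<in> topspace (overlap j {j, n})" if "z \<in> topspace ?T" for z
      using g(1)[OF that] n by (auto simp: topspace_overlap)
    show "continuous_map ?T (X m) (\<lambda>z. chart m (\<iota> j (?g z)))" if "m \<in> {j, n}" for m
    proof (rule continuous_map_eq)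
      show "continuous_map ?T (X m) (\<lambda>z. chart m (\<iota> i (fst z)))" using that n by (intro n_cont) auto
    qed (simp add: g(2))
  qed
  then have "continuous_map ?T (prod_topology (overlap j {j, i}) (overlap j {j, k})) (\<lambda>z. (?g z, ?g z))"
    by (auto simp: continuous_map_pairwise o_def)
  then show ?thesis
    by (auto simp: triple_def[of _ j] pullback_space_def cov_data_simps intro: continuous_map_into_subtopology)
qed

text \<open>For the openness of the transition maps on triple overlaps it is enough that they are invertible.\<close>

lemma phi3_open:
  assumes I: "i \<in> I" "j \<in> I" "k \<in> I"
  shows "open_map (triple cov_data i j k) (triple cov_data j i k) (phi3 cov_data k i j)"
proof -
  have inverse: "phi3 cov_data k j i (phi3 cov_data k i j z) = z"
    if "z \<in> topspace (triple cov_data i j k)" "i \<in> I" for z i j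
    using that(1) by (rule in_tripleE) (simp add: cov_data_simps \<iota>_chart chart_\<iota> that(2))
  then have "homeomorphic_maps (triple cov_data i j k) (triple cov_data j i k)
      (phi3 cov_data k i j) (phi3 cov_data k j i)"
    unfolding homeomorphic_maps_def
    using I phi3_continuous[of i j k] phi3_continuous[of j i k] by blast
  then show ?thesis unfolding homeomorphic_maps_map by (blast intro: homeomorphic_imp_open_map)
qed

lemma ups_phi_mor:
  assumes "i \<in> I" "j \<in> I"
  shows "top_mor op (overlap i {i, j}) (X i) (\<lambda>x. x)"
    and "top_mor op (overlap i {i, j}) (overlap j {j, i}) (\<lambda>x. chart j (\<iota> i x))"
proof -
  have "top_mor op (overlap i {i, j}) (overlap i {i}) (\<lambda>x. chart i (\<iota> i x))"
    using assms by (intro transition_mor) auto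
  then have "top_mor op (overlap i {i, j}) (X i) (\<lambda>x. chart i (\<iota> i x))"
    using overlap_singleton assms(1) by simp
  then show "top_mor op (overlap i {i, j}) (X i) (\<lambda>x. x)"
    by (rule top_mor_eq) (use assms in \<open>auto simp: topspace_overlap chart_\<iota>\<close>)
  show "top_mor op (overlap i {i, j}) (overlap j {j, i}) (\<lambda>x. chart j (\<iota> i x))"
    using assms by (intro transition_mor) auto
qed

lemma top_gluing_data_cov_data: "top_gluing_data I cov_data"
  unfolding top_gluing_data_def
proof (intro conjI ballI)
  fix i j k assume I: "i \<in> I" "j \<in> I" "k \<in> I"
  show "continuous_map (triple cov_data i j k) (triple cov_data j i k) (phi3 cov_data k i j)"
    using I by (rule phi3_continuous)
  fix z assume "z \<in> topspace (triple cov_data i j k)"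
  then show "phi3 cov_data j i k (prod.swap z) =
      prod.swap (phi3 cov_data i j k (prod.swap (phi3 cov_data k i j z)))"
    by (rule in_tripleE) (simp add: cov_data_simps \<iota>_chart)
  show "fst (phi3 cov_data k i j z) = phi cov_data i j (fst z)"
    by (simp add: cov_data_simps)
qed (use ups_phi_mor overlap_singleton chart_\<iota> in \<open>auto simp: cov_data_simps top_mor_def\<close>)

lemma all_maps_open_cov_data: "op \<Longrightarrow> all_maps_open I cov_data"
  unfolding all_maps_open_def
  using phi3_open ups_phi_mor by (auto simp: top_mor_def cov_data_simps)

lemma covers_with_overlaps_cov_data: "covers_with_overlaps I U \<iota> cov_data"
proof -
  have "\<iota> i ` topspace (overlap i {i, j}) = \<iota> i ` topspace (X i) \<inter> \<iota> j ` topspace (X j)" for i j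
    by (auto simp: topspace_overlap)
  then show ?thesis
    using cover unfolding covers_with_overlaps_def by (auto simp: cov_data_simps Int_commute)
qed

end

text \<open>A subset of \<open>U\<close> is the union of the images of its preimages in the pieces; for an open covering
  these images are open as soon as the preimages are.\<close>

lemma gluing_open_covering_imp_final_topology:
  assumes "gluing_open_covering I U X \<iota>"
  shows "final_topology I U X \<iota>"
  unfolding final_topology_def
proof (intro allI iffI conjI ballI)
  fix V i assume "openin U V" "i \<in> I"
  then show "openin (X i) {x \<in> topspace (X i). \<iota> i x \<in> V}"
    using assms unfolding gluing_open_covering_def by (blast intro: openin_continuous_map_preimage)
next
  fix V assume V: "V \<subseteq> topspace U \<and> (\<forall>i\<in>I. openin (X i) {x \<in> topspace (X i). \<iota> i x \<in> V})"
  then have "V = (\<Union>i\<in>I. \<iota> i ` {x \<in> topspace (X i). \<iota> i x \<in> V})"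
  proof (intro equalityI subsetI)
    fix u assume u: "u \<in> V"
    then have "u \<in> (\<Union>i\<in>I. \<iota> i ` topspace (X i))"
      using V assms unfolding gluing_open_covering_def by auto
    then show "u \<in> (\<Union>i\<in>I. \<iota> i ` {x \<in> topspace (X i). \<iota> i x \<in> V})" using u by auto
  qed auto
  moreover have "openin U (\<Union>i\<in>I. \<iota> i ` {x \<in> topspace (X i). \<iota> i x \<in> V})"
    using V assms unfolding gluing_open_covering_def open_map_def by (intro openin_Union) auto
  ultimately show "openin U V" by simp
qed (rule openin_subset)

section \<open>The equivalence\<close>

lemma gluing_covering_iff:
  "gluing_covering I U X \<iota> \<longleftrightarrow> space_covering False I U X \<iota>"
  unfolding gluing_covering_def space_covering_def top_mor_def by blast

lemma gluing_open_covering_iff: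
  "gluing_open_covering I U X \<iota> \<longleftrightarrow> space_covering True I U X \<iota>"
  unfolding gluing_open_covering_def space_covering_def top_mor_def by blast

theorem lemma2p12:
  fixes I :: "'i set" and U :: "'u topology" and X :: "'i \<Rightarrow> 'u topology" and \<iota> :: "'i \<Rightarrow> 'u \<Rightarrow> 'u"
  assumes "infinite (UNIV :: 'u set)" and "I \<lesssim> (UNIV :: 'u set)"
    and "\<And>i. i \<in> I \<Longrightarrow> \<iota> i \<in> topspace (X i) \<rightarrow> topspace U"
  shows
    "(final_topology I U X \<iota> \<longrightarrow>
        (gluing_covering I U X \<iota> \<longleftrightarrow>
          (\<exists>G. associated_functor Top I U X \<iota> G \<and> glued_by_functor Top I U X \<iota> G)) \<and>
        ((\<exists>G. associated_functor Top I U X \<iota> G \<and> glued_by_functor Top I U X \<iota> G) \<longleftrightarrow>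
          (\<exists>D. associated_data I U X \<iota> D \<and> covers_with_overlaps I U \<iota> D))) \<and>
     ((\<exists>G. associated_functor Top I U X \<iota> G \<and> glued_by_functor Top I U X \<iota> G) \<longrightarrow>
        gluing_covering I U X \<iota>) \<and>
     (gluing_covering I U X \<iota> \<longleftrightarrow>
        (\<exists>D. associated_data I U X \<iota> D \<and> covers_with_overlaps I U \<iota> D)) \<and>
     (gluing_open_covering I U X \<iota> \<longleftrightarrow>
        (\<exists>G. associated_functor oTop I U X \<iota> G \<and> glued_by_functor oTop I U X \<iota> G)) \<and>
     ((\<exists>G. associated_functor oTop I U X \<iota> G \<and> glued_by_functor oTop I U X \<iota> G) \<longleftrightarrow>
        (\<exists>D. associated_open_data I U X \<iota> D \<and> covers_with_overlaps I U \<iota> D))"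
proof -
  have data: "gluing_covering I U X \<iota> \<longleftrightarrow>
      (\<exists>D. associated_data I U X \<iota> D \<and> covers_with_overlaps I U \<iota> D)"
  proof
    assume cov: "gluing_covering I U X \<iota>"
    then interpret space_covering False I U X \<iota> by (simp add: gluing_covering_iff)
    show "\<exists>D. associated_data I U X \<iota> D \<and> covers_with_overlaps I U \<iota> D"
      using cov top_gluing_data_cov_data covers_with_overlaps_cov_data cov_data_simps(1)
      unfolding associated_data_def by metis
  qed (auto simp: associated_data_def)
  have open_data: "gluing_open_covering I U X \<iota> \<longleftrightarrow>
      (\<exists>D. associated_open_data I U X \<iota> D \<and> covers_with_overlaps I U \<iota> D)"
  proof
    assume cov: "gluing_open_covering I U X \<iota>"
    then interpret space_covering True I U X \<iota> by (simp add: gluing_open_covering_iff)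
    show "\<exists>D. associated_open_data I U X \<iota> D \<and> covers_with_overlaps I U \<iota> D"
      using cov top_gluing_data_cov_data all_maps_open_cov_data covers_with_overlaps_cov_data
        cov_data_simps(1)
      unfolding associated_open_data_def by metis
  qed (auto simp: associated_open_data_def)
  have covering_of_functor: "space_covering op I U X \<iota>"
    if "associated_functor (top_cat op) I U X \<iota> G" for op G
    using associated_functor_imp_covering[OF assms(1,2) that] unfolding space_covering_def by blast
  have functor_of_covering: "\<exists>G. associated_functor (top_cat op) I U X \<iota> G"
    if "space_covering op I U X \<iota>" "final_topology I U X \<iota>" for op
    using space_covering.associated_cov_functor[OF that] by blast
  have glued: "associated_functor C I U X \<iota> G \<and> glued_by_functor C I U X \<iota> G \<longleftrightarrow>
      associated_functor C I U X \<iota> G" for C G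
    by (auto simp: associated_functor_def)
  have Top: "top_cat False = Top" and oTop: "top_cat True = oTop"
    by (simp_all add: top_cat_def)
  have functor_imp: "(\<exists>G. associated_functor Top I U X \<iota> G) \<Longrightarrow> gluing_covering I U X \<iota>"
    using covering_of_functor[of False] unfolding gluing_covering_iff Top by blast
  have functor_ex: "\<exists>G. associated_functor Top I U X \<iota> G"
    if "gluing_covering I U X \<iota>" "final_topology I U X \<iota>"
    using functor_of_covering[of False] that unfolding gluing_covering_iff Top by blast
  have open_functor: "gluing_open_covering I U X \<iota> \<longleftrightarrow> (\<exists>G. associated_functor oTop I U X \<iota> G)"
    using covering_of_functor[of True] functor_of_covering[of True]
      gluing_open_covering_imp_final_topology[of I U X \<iota>]
    unfolding gluing_open_covering_iff oTop by blast
  show ?thesis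
    unfolding glued data[symmetric] open_data[symmetric] open_functor[symmetric]
    using functor_imp functor_ex by blast
qed

end
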